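(* Let $n\ge2$. For every workload $\mathcal T$ of $n$ transactions with global balancing ratio $\beta$, with probability at least $1-1/n$ Algorithm Non-Clairvoyant satisfies $$CR_{Non\text{-}Clairvoyant}(\mathcal T)\le 512e\,\ell\sqrt{s/\beta}\,\ln n+1=O\!\left(\ell\sqrt{s/\beta}\,\log n\right).$$ In particular, for balanced workloads ($\beta=\Theta(1)$) with $\ell=O(1)$, $CR_{Non\text{-}Clairvoyant}(\mathcal T)=O(\sqrt s\log n)$ with probability at least $1-1/n$.
   Context: Model. A workload is a set $\mathcal T=\{T_1,\dots,T_n\}$ of $n\ge1$ transactions (one per thread), all issued at time $0$, over a set $\mathcal R=\{R_1,\dots,R_s\}$ of $s$ shared resources. Each transaction $T$ reads the resources in $\mathcal R_r(T)$ and writes those in $\mathcal R_w(T)$; $\mathcal R(T)=\mathcal R_r(T)\cup\mathcal R_w(T)$, $\lambda(T)=|\mathcal R(T)|\ge1$, $\lambda_w(T)=|\mathcal R_w(T)|$. $T$ is read-only if $\lambda_w(T)=0$ and writing otherwise; at least one transaction is writing. Transactions $T,T'$ conflict if some resource lies in $(\mathcal R_w(T)\cap\mathcal R(T'))\cup(\mathcal R(T)\cap\mathcal R_w(T'))$; the conflict graph has the transactions as vertices and an edge between each conflicting pair. Time is discrete and synchronous; each transaction $T_i$ has a fixed integer execution time $\tau_i\ge1$ and commits once it has executed $\tau_i$ consecutive time steps without being aborted. Whenever two running transactions conflict, the contention manager aborts one of them; an aborted transaction restarts immediately from scratch (greedy schedule). The makespan of an algorithm on a workload is the time until all its transactions have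 committed; $\mathrm{makespan}_{opt}$ is the minimum makespan of any schedule in which conflicting transactions never execute simultaneously (optimal offline scheduler); the competitive ratio is $CR_{\mathcal A}=\mathrm{makespan}_{\mathcal A}/\mathrm{makespan}_{opt}$. The balancing ratio of a writing transaction is $\beta(T)=\lambda_w(T)/\lambda(T)\in[1/s,1]$; the global balancing ratio $\beta$ is the minimum of $\beta(T)$ over writing transactions. $\tau_{\max}=\max_i\tau_i$, $\tau_{\min}=\min_i\tau_i$, $\ell=\lceil\log_2(\tau_{\max}/\tau_{\min})\rceil+1$. Grouping. Writing transactions are partitioned into groups $A_0,\dots,A_{\ell-1}$, where $A_i$ contains those with execution time in $[2^i\tau_{\min},(2^{i+1}-1)\tau_{\min}]$; each $A_i$ is partitioned into subgroups $A_i^0,\dots,A_i^{\kappa-1}$, $\kappa=\lceil\log_2 s\rceil+1$, where $A_i^j$ contains those $T$ with $\lambda(T)\in[\lambda^j_{\min},\lambda^j_{\max}]$, $\lambda^j_{\min}=2^j$, $\lambda^j_{\max}=2^{j+1}-1$. Read-only transactions form a group $B$. Subgroups are ordered by $A_i^j<A_k^l$ iff $i<k$ or ($i=k$ and $j<l$), and $B$ is placed after all subgroups. Algorithm Non-Clairvoyant. All pending transactions execute at every step. Every time a transaction $T$ (re)starts it draws $r(T)$ uniformly at random from $\{1,\dots,n\}$, independently. When running transactions $T_u\in A_i^j$ and $T_v\in A_k^l$ conflict: if $A_i^j<A_k^l$ then $T_u$ aborts $T_v$; if $A_i^j>A_k^l$ then $T_v$ aborts $T_u$; if they are in the same subgroup,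 then $T_u$ aborts $T_v$ if $r(T_u)<r(T_v)$ and otherwise $T_v$ aborts $T_u$; moreover, after $T_u$ aborts $T_v$ on account of $r(T_u)<r(T_v)$, the restarted $T_v$ cannot abort $T_u$ until $T_u$ commits or is aborted.
   Formalization: Group A_i is taken as execution times in [2^i τ_min, 2^{i+1} τ_min), since the stated intervals leave gaps (τ_min=2, τ=3 lies in no group); the O(·) form and the "in particular" clause, immediate from the explicit bound, are not stated. *)

theory Defs
  imports "HOL-Probability.Probability"
begin

text \<open>Transactions are indexed 0..<n, resources 0..<s.\<close>

record workload =
  nT  :: nat
  nR  :: nat                    \<comment> \<open>number s of shared resources\<close>
  rd  :: "nat \<Rightarrow> nat set"
  wr  :: "nat \<Rightarrow> nat set"
  tau :: "nat \<Rightarrow> nat"            \<comment> \<open>execution time tau_i\<close>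

definition res :: "workload \<Rightarrow> nat \<Rightarrow> nat set" where
  "res W i = rd W i \<union> wr W i"

definition lam :: "workload \<Rightarrow> nat \<Rightarrow> nat" where
  "lam W i = card (res W i)"

definition lam_w :: "workload \<Rightarrow> nat \<Rightarrow> nat" where
  "lam_w W i = card (wr W i)"

definition writing :: "workload \<Rightarrow> nat \<Rightarrow> bool" where
  "writing W i \<longleftrightarrow> wr W i \<noteq> {}"

definition valid_workload :: "workload \<Rightarrow> bool" where
  "valid_workload W \<longleftrightarrow> nT W \<ge> 1 \<and>
     (\<forall>i<nT W. rd W i \<subseteq> {0..<nR W} \<and> wr W i \<subseteq> {0..<nR W} \<and>
                res W i \<noteq> {} \<and> tau W i \<ge> 1) \<and>
     (\<exists>i<nT W. writing W i)"

definition conflict :: "workload \<Rightarrow> nat \<Rightarrow> nat \<Rightarrow> bool" where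
  "conflict W u v \<longleftrightarrow>
     (wr W u \<inter> res W v) \<union> (res W u \<inter> wr W v) \<noteq> {}"

definition tau_max :: "workload \<Rightarrow> nat" where
  "tau_max W = Max (tau W ` {0..<nT W})"

definition tau_min :: "workload \<Rightarrow> nat" where
  "tau_min W = Min (tau W ` {0..<nT W})"

definition ell :: "workload \<Rightarrow> nat" where
  "ell W = nat \<lceil>log 2 (real (tau_max W) / real (tau_min W))\<rceil> + 1"

definition beta :: "workload \<Rightarrow> real" where
  "beta W = Min ((\<lambda>i. real (lam_w W i) / real (lam W i)) ` {i. i < nT W \<and> writing W i})"

definition grp_idx :: "workload \<Rightarrow> nat \<Rightarrow> nat" where
  "grp_idx W t = nat \<lfloor>log 2 (real (tau W t) / real (tau_min W))\<rfloor>"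

definition sub_idx :: "workload \<Rightarrow> nat \<Rightarrow> nat" where
  "sub_idx W t = nat \<lfloor>log 2 (real (lam W t))\<rfloor>"

text \<open>Key of the (sub)group of a transaction; read-only transactions (group B) get
  key (ell, 0), which is lexicographically after every subgroup A_i^j (i < ell).\<close>
definition key :: "workload \<Rightarrow> nat \<Rightarrow> nat \<times> nat" where
  "key W t = (if writing W t then (grp_idx W t, sub_idx W t) else (ell W, 0))"

definition key_lt :: "nat \<times> nat \<Rightarrow> nat \<times> nat \<Rightarrow> bool" where
  "key_lt a b \<longleftrightarrow> fst a < fst b \<or> (fst a = fst b \<and> snd a < snd b)"

record nc_state =
  committed :: "nat \<Rightarrow> bool"
  prog      :: "nat \<Rightarrow> nat"          \<comment> \<open>steps executed since last (re)start\<close>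
  rv        :: "nat \<Rightarrow> nat"
  prot      :: "nat \<Rightarrow> nat \<Rightarrow> bool"  \<comment> \<open>prot u v: v may not abort u\<close>

definition active :: "workload \<Rightarrow> nc_state \<Rightarrow> nat \<Rightarrow> bool" where
  "active W \<sigma> u \<longleftrightarrow> u < nT W \<and> \<not> committed \<sigma> u"

definition rbeats :: "workload \<Rightarrow> nc_state \<Rightarrow> nat \<Rightarrow> nat \<Rightarrow> bool" where
  "rbeats W \<sigma> u v \<longleftrightarrow> active W \<sigma> u \<and> active W \<sigma> v \<and> u \<noteq> v \<and> conflict W u v \<and>
     key W u = key W v \<and> \<not> prot \<sigma> u v \<and> \<not> prot \<sigma> v u \<and>
     (rv \<sigma> u < rv \<sigma> v \<or> (rv \<sigma> u = rv \<sigma> v \<and> u < v))"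

definition beats :: "workload \<Rightarrow> nc_state \<Rightarrow> nat \<Rightarrow> nat \<Rightarrow> bool" where
  "beats W \<sigma> u v \<longleftrightarrow> active W \<sigma> u \<and> active W \<sigma> v \<and> u \<noteq> v \<and> conflict W u v \<and>
     (key_lt (key W u) (key W v) \<or>
      (key W u = key W v \<and> (prot \<sigma> u v \<or> rbeats W \<sigma> u v)))"

definition aborted :: "workload \<Rightarrow> nc_state \<Rightarrow> nat \<Rightarrow> bool" where
  "aborted W \<sigma> v \<longleftrightarrow> (\<exists>u. beats W \<sigma> u v)"

definition commits_now :: "workload \<Rightarrow> nc_state \<Rightarrow> nat \<Rightarrow> bool" where
  "commits_now W \<sigma> i \<longleftrightarrow> active W \<sigma> i \<and> \<not> aborted W \<sigma> i \<and> prog \<sigma> i + 1 \<ge> tau W i"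

definition nc_next :: "workload \<Rightarrow> nc_state \<Rightarrow> (nat \<Rightarrow> nat) \<Rightarrow> nc_state" where
  "nc_next W \<sigma> d =
     \<lparr> committed = (\<lambda>i. committed \<sigma> i \<or> commits_now W \<sigma> i),
       prog = (\<lambda>i. if active W \<sigma> i \<and> \<not> aborted W \<sigma> i then prog \<sigma> i + 1 else 0),
       rv = (\<lambda>i. if aborted W \<sigma> i then d i else rv \<sigma> i),
       prot = (\<lambda>u v. (prot \<sigma> u v \<or> rbeats W \<sigma> u v) \<and>
                      \<not> aborted W \<sigma> u \<and> \<not> commits_now W \<sigma> u) \<rparr>"

definition nc_init :: "(nat \<Rightarrow> nat) \<Rightarrow> nc_state" where
  "nc_init d = \<lparr> committed = (\<lambda>_. False), prog = (\<lambda>_. 0), rv = d, prot = (\<lambda>_ _. False) \<rparr>"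

definition draws :: "workload \<Rightarrow> (nat \<Rightarrow> nat) pmf" where
  "draws W = Pi_pmf {..<nT W} 0 (\<lambda>_. pmf_of_set {1..nT W})"

fun nc_dist :: "workload \<Rightarrow> nat \<Rightarrow> nc_state pmf" where
  "nc_dist W 0 = map_pmf nc_init (draws W)"
| "nc_dist W (Suc k) = bind_pmf (nc_dist W k) (\<lambda>\<sigma>. map_pmf (nc_next W \<sigma>) (draws W))"

definition all_committed :: "workload \<Rightarrow> nc_state \<Rightarrow> bool" where
  "all_committed W \<sigma> \<longleftrightarrow> (\<forall>i<nT W. committed \<sigma> i)"

text \<open>Probability that makespan of Non-Clairvoyant is at most x (x \<ge> 0):
  the makespan is at most x iff all transactions have committed by time floor x.\<close>
definition prob_makespan_NC_le :: "workload \<Rightarrow> real \<Rightarrow> real" where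
  "prob_makespan_NC_le W x =
     measure_pmf.prob (nc_dist W (nat \<lfloor>x\<rfloor>)) {\<sigma>. all_committed W \<sigma>}"

text \<open>A feasible offline schedule: start times a_i, transaction i runs during
  [a_i, a_i + tau_i), conflicting transactions never overlap.\<close>
definition feasible_offline :: "workload \<Rightarrow> (nat \<Rightarrow> nat) \<Rightarrow> bool" where
  "feasible_offline W a \<longleftrightarrow>
     (\<forall>i<nT W. \<forall>j<nT W. i \<noteq> j \<and> conflict W i j \<longrightarrow>
        a i + tau W i \<le> a j \<or> a j + tau W j \<le> a i)"

definition makespan_opt :: "workload \<Rightarrow> nat" where
  "makespan_opt W = (LEAST m. \<exists>a. feasible_offline W a \<and> (\<forall>i<nT W. a i + tau W i \<le> m))"

end

(* Once a transaction survives a step, the protection rule lets it run until it commits, and all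
   conflicting transactions of its subgroup restart, with fresh numbers, in every step meanwhile.
   A waiting transaction with at most m - 1 live rivals, each running for less than L steps, is thus
   held back by running rivals for at most (m - 1) (L - 1) steps, and in every other step it starts
   its final run with probability at least 1 / (5 m). Hence it is still live after 3 m L steps with
   probability at most 2/5.

   The conflict graph of a subgroup may have large maximum degree, but orienting each conflict
   towards a writer of the shared resource bounds all out-degrees by lambda_max M, where M is the
   maximal number of writers of a resource. So at least half of the live transactions have degree
   at most 4 lambda_max M, also trivially bounded by the size of the subgroup, which is at most
   (s / beta) M / lambda_min. Each window of 3 m L steps therefore reduces the expected number of live
   transactions by the factor 7/10, and O(log n) windows make it at most 1/n^2 times the initial number.
   Since the writers of one resource form a clique, M L <= 2 makespan_opt; summing
   min(8 * 2^j, (s / beta) / 2^j) over j gives O(sqrt(s / beta)) for each of the ell groups. *)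
theory Submission
  imports Defs
begin

section \<open>Reduction to the chain of committed sets and progress\<close>

type_synonym run_state = "(nat \<Rightarrow> bool) \<times> (nat \<Rightarrow> nat)"

definition live :: "workload \<Rightarrow> run_state \<Rightarrow> nat \<Rightarrow> bool" where
  "live W a i \<longleftrightarrow> i < nT W \<and> \<not> fst a i"

text \<open>Abortion without stored numbers or protection: positive progress of a peer stands for
  its protection, and waiting transactions compare their numbers in the fresh draw
  \<open>d\<close>.\<close>

definition blocked :: "workload \<Rightarrow> run_state \<Rightarrow> (nat \<Rightarrow> nat) \<Rightarrow> nat \<Rightarrow> bool" where
  "blocked W a d v \<longleftrightarrow> live W a v \<and> snd a v = 0 \<and>
     (\<exists>u. live W a u \<and> u \<noteq> v \<and> conflict W u v \<and>
        (key_lt (key W u) (key W v) \<or>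
         key W u = key W v \<and> (snd a u > 0 \<or> d u < d v \<or> d u = d v \<and> u < v)))"

text \<open>The draw is consumed at the start of the step, whereas \<open>nc_next\<close> stores it
  at the end for the following step; hence \<open>run_init\<close> carries no numbers.\<close>

definition run_step :: "workload \<Rightarrow> run_state \<Rightarrow> (nat \<Rightarrow> nat) \<Rightarrow> run_state" where
  "run_step W a d =
     (\<lambda>i. fst a i \<or> live W a i \<and> \<not> blocked W a d i \<and> snd a i + 1 \<ge> tau W i,
      \<lambda>i. if live W a i \<and> \<not> blocked W a d i then snd a i + 1 else 0)"

definition proj :: "nc_state \<Rightarrow> run_state" where
  "proj \<sigma> = (committed \<sigma>, prog \<sigma>)"

definition run_init :: run_state where
  "run_init = (\<lambda>_. False, \<lambda>_. 0)"

primrec run_dist :: "workload \<Rightarrow> nat \<Rightarrow> run_state pmf" where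
  "run_dist W 0 = return_pmf run_init"
| "run_dist W (Suc k) = bind_pmf (run_dist W k) (\<lambda>a. map_pmf (run_step W a) (draws W))"

text \<open>In every reachable state, a transaction that survived the last step is protected from all its
  conflicting peers and is not dominated by any smaller key, so it runs until it commits.\<close>
definition consistent :: "workload \<Rightarrow> nc_state \<Rightarrow> bool" where
  "consistent W \<sigma> \<longleftrightarrow>
     (\<forall>u v. active W \<sigma> u \<and> prog \<sigma> u > 0 \<and> active W \<sigma> v \<and> u \<noteq> v \<and> conflict W u v \<longrightarrow>
        \<not> key_lt (key W v) (key W u) \<and>
        (key W u = key W v \<longrightarrow> prot \<sigma> u v \<and> prog \<sigma> v = 0)) \<and>
     (\<forall>u v. active W \<sigma> u \<and> prog \<sigma> u = 0 \<longrightarrow> \<not> prot \<sigma> u v)"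

text \<open>A transaction with zero progress was aborted in the last step (or has not started yet), so its
  number is fresh: redrawing the numbers of all these transactions leaves the distribution of
  the state unchanged. This makes the pair of committed set and progress a Markov chain.\<close>
definition redraw :: "workload \<Rightarrow> nc_state \<Rightarrow> (nat \<Rightarrow> nat) \<Rightarrow> nc_state" where
  "redraw W \<sigma> d = \<sigma>\<lparr>rv := (\<lambda>i. if active W \<sigma> i \<and> prog \<sigma> i = 0 then d i else rv \<sigma> i)\<rparr>"

lemma conflict_sym: "conflict W u v = conflict W v u"
  unfolding conflict_def by auto

lemma active_redraw [simp]: "active W (redraw W \<sigma> d) = active W \<sigma>"
  by (auto simp: active_def redraw_def fun_eq_iff)

lemma consistent_init: "consistent W (nc_init d)"
  by (simp add: consistent_def nc_init_def)

text \<open>Ties are broken by index, so if neither of two conflicting peers is protected, one of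
  them wins.\<close>

lemma unaborted_beats:
  assumes "active W \<sigma> u" "active W \<sigma> v" "u \<noteq> v" "conflict W u v" "key W u = key W v"
    and "\<not> aborted W \<sigma> u"
  shows "prot \<sigma> u v \<or> rbeats W \<sigma> u v"
proof -
  have "\<not> beats W \<sigma> v u" using assms(6) by (auto simp: aborted_def)
  then show ?thesis
    using assms(1-5) conflict_sym[of W u v] unfolding beats_def rbeats_def by fastforce
qed

lemma active_next: "active W (nc_next W \<sigma> d) u \<longleftrightarrow> active W \<sigma> u \<and> \<not> commits_now W \<sigma> u"
  by (auto simp: active_def nc_next_def)

lemma aborted_active: "aborted W \<sigma> v \<Longrightarrow> active W \<sigma> v"
  by (auto simp: aborted_def beats_def)

text \<open>A survivor has won against every conflicting peer of its subgroup, which records its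
  protection and resets their progress; an abort erases protection.\<close>

lemma consistent_next: "consistent W (nc_next W \<sigma> d)"
proof -
  have "\<not> key_lt (key W v) (key W u) \<and>
        (key W u = key W v \<longrightarrow> prot (nc_next W \<sigma> d) u v \<and> prog (nc_next W \<sigma> d) v = 0)"
    if "active W (nc_next W \<sigma> d) u" "prog (nc_next W \<sigma> d) u > 0"
       "active W (nc_next W \<sigma> d) v" "u \<noteq> v" "conflict W u v" for u v
  proof -
    have u: "active W \<sigma> u" "\<not> commits_now W \<sigma> u" "\<not> aborted W \<sigma> u"
      and v: "active W \<sigma> v"
      using that(1-3) by (auto simp: active_next) (auto simp: nc_next_def split: if_splits)
    have nb: "\<not> beats W \<sigma> v u" using u by (auto simp: aborted_def)
    then have "\<not> key_lt (key W v) (key W u)"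
      using that u v conflict_sym[of W u v] by (auto simp: beats_def)
    moreover have "prot (nc_next W \<sigma> d) u v \<and> prog (nc_next W \<sigma> d) v = 0" if "key W u = key W v"
    proof -
      have *: "prot \<sigma> u v \<or> rbeats W \<sigma> u v"
        using unaborted_beats u v that \<open>u \<noteq> v\<close> \<open>conflict W u v\<close> by blast
      then have "beats W \<sigma> u v"
        using u v that \<open>u \<noteq> v\<close> \<open>conflict W u v\<close> by (auto simp: beats_def)
      then have "aborted W \<sigma> v" by (auto simp: aborted_def)
      then show ?thesis using * u by (auto simp: nc_next_def)
    qed
    ultimately show ?thesis by blast
  qed
  moreover have "\<not> prot (nc_next W \<sigma> d) u v"
    if "active W (nc_next W \<sigma> d) u" "prog (nc_next W \<sigma> d) u = 0" for u v
  proof -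
    have "aborted W \<sigma> u"
      using that by (auto simp: active_next) (auto simp: nc_next_def split: if_splits)
    then show ?thesis by (simp add: nc_next_def)
  qed
  ultimately show ?thesis unfolding consistent_def by blast
qed

text \<open>Consistency removes the history: a running transaction is beaten by nobody, and a
  waiting one holds no protection, so it loses to running rivals through their protection and meets
  waiting rivals through fresh numbers.\<close>

lemma aborted_iff_blocked:
  assumes "consistent W \<sigma>"
  shows "aborted W (redraw W \<sigma> d) v \<longleftrightarrow> blocked W (proj \<sigma>) d v"
proof -
  let ?\<rho> = "redraw W \<sigma> d"
  note c = assms[unfolded consistent_def]
  have lv: "live W (proj \<sigma>) u = active W \<sigma> u" for u
    by (simp add: live_def active_def proj_def)
  have rb: "rbeats W ?\<rho> u v \<longleftrightarrow> active W \<sigma> u \<and> active W \<sigma> v \<and> u \<noteq> v \<and> conflict W u v \<and>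
     key W u = key W v \<and> \<not> prot \<sigma> u v \<and> \<not> prot \<sigma> v u \<and>
     (rv ?\<rho> u < rv ?\<rho> v \<or> (rv ?\<rho> u = rv ?\<rho> v \<and> u < v))" for u v
    unfolding rbeats_def active_redraw by (simp add: redraw_def)
  have be: "beats W ?\<rho> u v \<longleftrightarrow> active W \<sigma> u \<and> active W \<sigma> v \<and> u \<noteq> v \<and> conflict W u v \<and>
     (key_lt (key W u) (key W v) \<or>
      (key W u = key W v \<and> (prot \<sigma> u v \<or> rbeats W ?\<rho> u v)))" for u v
    unfolding beats_def active_redraw by (simp add: redraw_def)
  have rvw: "rv ?\<rho> u = d u" if "active W \<sigma> u" "prog \<sigma> u = 0" for u
    using that by (simp add: redraw_def)
  have run: "\<not> beats W ?\<rho> u v" if v: "prog \<sigma> v > 0" for u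
  proof
    assume b: "beats W ?\<rho> u v"
    then have a: "active W \<sigma> u" "active W \<sigma> v" "v \<noteq> u" "conflict W v u"
      using conflict_sym[of W u v] by (auto simp: be)
    with c v have "\<not> key_lt (key W u) (key W v)" by blast
    with b have k: "key W u = key W v" and pr: "prot \<sigma> u v \<or> rbeats W ?\<rho> u v"
      by (auto simp: be)
    with a c v have "prot \<sigma> v u" "prog \<sigma> u = 0" by metis+
    moreover from this a c have "\<not> prot \<sigma> u v" by blast
    ultimately show False using pr by (auto simp: rb)
  qed
  have wait: "beats W ?\<rho> u v \<longleftrightarrow> live W (proj \<sigma>) v \<and> live W (proj \<sigma>) u \<and> u \<noteq> v \<and> conflict W u v \<and>
        (key_lt (key W u) (key W v) \<or>
         key W u = key W v \<and> (prog \<sigma> u > 0 \<or> d u < d v \<or> d u = d v \<and> u < v))"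
    if v: "prog \<sigma> v = 0" for u
  proof (cases "active W \<sigma> u \<and> active W \<sigma> v \<and> u \<noteq> v \<and> conflict W u v")
    case True
    have nv: "\<not> prot \<sigma> v u" using c True v by blast
    show ?thesis
    proof (cases "prog \<sigma> u = 0")
      case u: True
      then have "\<not> prot \<sigma> u v" using c True by blast
      with True nv u v show ?thesis by (auto simp: be rb lv rvw)
    next
      case u: False
      then have "key W u = key W v \<Longrightarrow> prot \<sigma> u v" using c True by blast
      with True u show ?thesis by (auto simp: be lv)
    qed
  qed (auto simp: be lv)
  show ?thesis
  proof (cases "prog \<sigma> v = 0")
    case True
    then show ?thesis unfolding aborted_def wait[OF True] blocked_def by (auto simp: proj_def)
  next
    case False
    then show ?thesis using run by (auto simp: aborted_def blocked_def proj_def)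
  qed
qed

text \<open>The Markov property: the projected successor depends on \<open>\<sigma>\<close> only
  through \<open>proj \<sigma>\<close>, while \<open>d'\<close> fixes numbers for the following
  step.\<close>

lemma proj_next_redraw:
  assumes "consistent W \<sigma>"
  shows "proj (nc_next W (redraw W \<sigma> d) d') = run_step W (proj \<sigma>) d"
  unfolding nc_next_def run_step_def commits_now_def aborted_iff_blocked[OF assms] active_redraw
  by (auto simp: proj_def redraw_def live_def active_def fun_eq_iff)

lemma draws_support:
  assumes "d \<in> set_pmf (draws W)" "i \<ge> nT W"
  shows "d i = 0"
  using assms set_Pi_pmf_subset'[of "{..<nT W}" 0 "\<lambda>_. pmf_of_set {1..nT W}"]
  by (auto simp: draws_def PiE_dflt_def)

text \<open>After a step the live transactions with zero progress are exactly those just aborted, so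
  redrawing overwrites what \<open>d\<close> supplied and nothing else.\<close>

lemma redraw_next: "redraw W (nc_next W \<sigma> d) = nc_next W \<sigma>"
proof
  fix d'
  have "active W (nc_next W \<sigma> d) i \<and> prog (nc_next W \<sigma> d) i = 0 \<longleftrightarrow> aborted W \<sigma> i" for i
    using aborted_active[of W \<sigma> i] by (auto simp: active_next) (auto simp: nc_next_def commits_now_def split: if_splits)
  then show "redraw W (nc_next W \<sigma> d) d' = nc_next W \<sigma> d'"
    unfolding redraw_def by (auto simp: nc_next_def fun_eq_iff)
qed

lemma nc_dist_redraw:
  "bind_pmf (nc_dist W k) (\<lambda>\<sigma>. map_pmf (redraw W \<sigma>) (draws W)) = nc_dist W k"
proof (cases k)
  case 0
  \<comment> \<open>Initially all transactions wait; beyond \<open>nT W\<close> both draws have the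
    default value 0, so the states agree at every index.\<close>
  have "redraw W (nc_init d) d' = nc_init d'"
    if "d \<in> set_pmf (draws W)" "d' \<in> set_pmf (draws W)" for d d'
    using that[THEN draws_support]
    by (auto simp: redraw_def nc_init_def active_def fun_eq_iff not_less)
  then have "bind_pmf (draws W) (\<lambda>d. map_pmf (redraw W (nc_init d)) (draws W)) =
             bind_pmf (draws W) (\<lambda>d. map_pmf nc_init (draws W))"
    by (intro bind_pmf_cong map_pmf_cong) auto
  then show ?thesis by (simp add: 0 bind_map_pmf)
next
  case (Suc k)
  show ?thesis
    by (simp add: Suc bind_assoc_pmf bind_map_pmf redraw_next)
qed

lemma consistent_nc_dist: "\<sigma> \<in> set_pmf (nc_dist W k) \<Longrightarrow> consistent W \<sigma>"
  by (cases k) (auto simp: consistent_init consistent_next)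

text \<open>\<open>nc_dist_redraw\<close>, read from right to left, inserts a redraw before the
  step; every step then uses fresh numbers, as in \<open>run_dist\<close>.\<close>

lemma proj_nc_dist: "map_pmf proj (nc_dist W k) = run_dist W k"
proof (induction k)
  case 0
  show ?case by (simp add: pmf.map_comp o_def proj_def nc_init_def run_init_def)
next
  case (Suc k)
  have "map_pmf proj (nc_dist W (Suc k)) =
    bind_pmf (bind_pmf (nc_dist W k) (\<lambda>\<sigma>. map_pmf (redraw W \<sigma>) (draws W)))
      (\<lambda>\<sigma>. map_pmf (\<lambda>d. proj (nc_next W \<sigma> d)) (draws W))"
    by (simp add: nc_dist_redraw map_bind_pmf pmf.map_comp o_def)
  also have "\<dots> = bind_pmf (nc_dist W k) (\<lambda>\<sigma>. bind_pmf (draws W) (\<lambda>d.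
                   map_pmf (\<lambda>d'. proj (nc_next W (redraw W \<sigma> d) d')) (draws W)))"
    by (simp add: bind_assoc_pmf bind_map_pmf)
  also have "\<dots> = bind_pmf (nc_dist W k) (\<lambda>\<sigma>. bind_pmf (draws W) (\<lambda>d.
                   map_pmf (\<lambda>d'. run_step W (proj \<sigma>) d) (draws W)))"
    by (intro bind_pmf_cong refl map_pmf_cong proj_next_redraw consistent_nc_dist)
  also have "\<dots> = bind_pmf (map_pmf proj (nc_dist W k)) (\<lambda>a. map_pmf (run_step W a) (draws W))"
    by (simp add: bind_map_pmf map_pmf_def[of _ "draws W"])
  finally show ?case by (simp add: Suc.IH)
qed

section \<open>Expectations along the chain\<close>

lemma finite_set_draws: 
  assumes "nT W > 0"
  shows "finite (set_pmf (draws W))"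
proof -
  have "set_pmf (draws W) = PiE_dflt {..<nT W} 0 (\<lambda>_. {1..nT W})"
    using assms by (auto simp: draws_def set_Pi_pmf PiE_dflt_def)
  also have "finite \<dots>" by (intro finite_PiE_dflt) auto
  finally show ?thesis .
qed

definition step_expectation :: "workload \<Rightarrow> (run_state \<Rightarrow> real) \<Rightarrow> run_state \<Rightarrow> real" where
  "step_expectation W f a = measure_pmf.expectation (draws W) (\<lambda>d. f (run_step W a d))"

text \<open>The transition operator iterated on observables: the expected value of \<open>f\<close>
  after \<open>t\<close> steps from \<open>a\<close>. Conditioning on a past state becomes a
  pointwise statement in \<open>a\<close>.\<close>

primrec run_expectation :: "workload \<Rightarrow> nat \<Rightarrow> (run_state \<Rightarrow> real) \<Rightarrow> run_state \<Rightarrow> real" where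
  "run_expectation W 0 f a = f a"
| "run_expectation W (Suc t) f a = step_expectation W (run_expectation W t f) a"

lemma run_expectation_add:
  "run_expectation W (s + t) f a = run_expectation W s (run_expectation W t f) a"
proof (induction s arbitrary: a)
  case (Suc s)
  then have "run_expectation W (s + t) f = run_expectation W s (run_expectation W t f)" by blast
  then show ?case by simp
qed simp

lemma integrable_draws: 
  fixes f :: "(nat \<Rightarrow> nat) \<Rightarrow> real"
  shows "nT W > 0 \<Longrightarrow> integrable (measure_pmf (draws W)) f"
  by (intro integrable_measure_pmf_finite finite_set_draws)

lemma step_expectation_mono:
  assumes "nT W > 0" "\<And>d. f (run_step W a d) \<le> g (run_step W a d)"
  shows "step_expectation W f a \<le> step_expectation W g a"
  unfolding step_expectation_def using assms by (intro integral_mono integrable_draws) auto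

lemma step_expectation_const [simp]: "step_expectation W (\<lambda>_. c) a = c"
  by (simp add: step_expectation_def)

lemma run_expectation_const [simp]: "run_expectation W t (\<lambda>_. c) a = c"
proof (induction t arbitrary: a)
  case (Suc t)
  then have "run_expectation W t (\<lambda>_. c) = (\<lambda>_. c)" by blast
  then show ?case by simp
qed simp

text \<open>The invariant \<open>Q\<close> confines the comparison of \<open>f\<close> and
  \<open>g\<close> to the states that matter.\<close>

lemma run_expectation_mono:
  assumes n: "nT W > 0"
    and inv: "\<And>a d. Q a \<Longrightarrow> Q (run_step W a d)"
    and le: "\<And>a. Q a \<Longrightarrow> f a \<le> g a"
    and "Q a"
  shows "run_expectation W t f a \<le> run_expectation W t g a"
  using \<open>Q a\<close>
proof (induction t arbitrary: a)
  case (Suc t)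
  then show ?case unfolding run_expectation.simps by (intro step_expectation_mono n Suc.IH inv)
qed (simp add: le)

lemma run_expectation_mult:
  "run_expectation W t (\<lambda>a. c * f a) a = c * run_expectation W t f a"
proof (induction t arbitrary: a)
  case (Suc t)
  then have "run_expectation W t (\<lambda>a. c * f a) = (\<lambda>a. c * run_expectation W t f a)" by blast
  then show ?case by (simp add: step_expectation_def)
qed simp

lemma run_expectation_add_const:
  assumes n: "nT W > 0"
  shows "run_expectation W t (\<lambda>a. f a + c) a = run_expectation W t f a + c"
proof (induction t arbitrary: a)
  case (Suc t)
  then have "run_expectation W t (\<lambda>a. f a + c) = (\<lambda>a. run_expectation W t f a + c)" by blast
  then show ?case by (simp add: step_expectation_def integrable_draws n)
qed simp

lemma run_expectation_sum:
  assumes n: "nT W > 0"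
  shows "run_expectation W t (\<lambda>a. \<Sum>v\<in>A. f v a) a = (\<Sum>v\<in>A. run_expectation W t (f v) a)"
proof (induction t arbitrary: a)
  case (Suc t)
  then have "run_expectation W t (\<lambda>a. \<Sum>v\<in>A. f v a) = (\<lambda>a. \<Sum>v\<in>A. run_expectation W t (f v) a)"
    by blast
  then show ?case
    by (simp add: step_expectation_def Bochner_Integration.integral_sum integrable_draws n)
qed simp

lemma finite_set_run_dist: 
  assumes "nT W > 0" shows "finite (set_pmf (run_dist W k))"
  by (induction k) (use assms in \<open>auto simp: finite_set_draws\<close>)

text \<open>\<open>run_dist\<close> appends a step at the end while \<open>run_expectation\<close>
  peels one off at the start; \<open>run_expectation_add\<close> reconciles the two.\<close>

lemma expectation_run_dist:
  fixes f :: "run_state \<Rightarrow> real"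
  assumes n: "nT W > 0"
  shows "measure_pmf.expectation (run_dist W k) f = run_expectation W k f run_init"
proof (induction k arbitrary: f)
  case (Suc k)
  have "measure_pmf.expectation (run_dist W (Suc k)) f =
        measure_pmf.expectation (run_dist W k) (step_expectation W f)"
    using n unfolding run_dist.simps step_expectation_def
    by (subst pmf_expectation_bind[OF finite_set_run_dist[of W k]])
       (auto simp: finite_set_draws integral_measure_pmf[OF finite_set_run_dist])
  also have "\<dots> = run_expectation W k (step_expectation W f) run_init" by (rule Suc.IH)
  also have "\<dots> = run_expectation W (k + 1) f run_init"
  proof -
    have "run_expectation W 1 f = step_expectation W f" by (auto simp: fun_eq_iff step_expectation_def)
    then show ?thesis unfolding run_expectation_add by simp
  qed
  finally show ?case by simp
qed simp

section \<open>Probability of drawing the strict minimum\<close>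

lemma sum_power_lower_bound: "real n ^ Suc k / Suc k \<le> (\<Sum>y<Suc n. real y ^ k)"
proof (induction n)
  case (Suc n)
  \<comment> \<open>The sum is compared with the integral of \<open>x ^ k\<close> from 0 to
    \<open>n\<close>; one induction step bounds the increment of \<open>x ^ Suc k\<close> by
    \<open>Suc k * (1 + n) ^ k\<close>.\<close>
  have "(1 + real n) ^ Suc k - real n ^ Suc k
     = (\<Sum>i<Suc k. real n ^ (Suc k - Suc i) * (1 + real n) ^ i)"
    using power_diff_sumr2[of "1 + real n" "Suc k" "real n"] by simp
  also have "\<dots> \<le> (\<Sum>i<Suc k. (1 + real n) ^ k)"
  proof (intro sum_mono)
    fix i assume "i \<in> {..<Suc k}"
    then have "real n ^ (Suc k - Suc i) * (1 + real n) ^ i \<le> (1 + real n) ^ (k - i) * (1 + real n) ^ i"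
      by (intro mult_right_mono) (auto intro!: power_mono)
    also have "\<dots> = (1 + real n) ^ k"
      using \<open>i \<in> _\<close> by (simp flip: power_add)
    finally show "real n ^ (Suc k - Suc i) * (1 + real n) ^ i \<le> (1 + real n) ^ k" .
  qed
  also have "\<dots> = Suc k * (1 + real n) ^ k" by simp
  finally have "(1 + real n) ^ Suc k \<le> real n ^ Suc k + Suc k * (1 + real n) ^ k"
    by linarith
  then have "(1 + real n) ^ Suc k / Suc k \<le> (real n ^ Suc k + Suc k * (1 + real n) ^ k) / Suc k"
    by (intro divide_right_mono) auto
  also have "\<dots> = real n ^ Suc k / Suc k + (1 + real n) ^ k"
    by (subst add_divide_distrib) (simp del: power_Suc)
  finally have "(1 + real n) ^ Suc k / Suc k \<le> real n ^ Suc k / Suc k + (1 + real n) ^ k" .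
  with Suc show ?case by (simp add: add.commute del: power_Suc)
qed simp

text \<open>Bernoulli's inequality on the full exponent gives only 0, so it is applied to both
  halves of \<open>n\<close>; the product is 1/4 for even \<open>n\<close> and at least 2/9 for odd
  \<open>n\<close>.\<close>

lemma one_minus_inverse_power_ge:
  assumes "n \<ge> (2::nat)"
  shows "(1 - 1 / real n) ^ n \<ge> 1 / 5"
proof -
  define h where "h = n div 2"
  have b: "(1 - 1 / real n) ^ k \<ge> 1 - k / real n" for k :: nat
    using Bernoulli_inequality[of "-1 / real n" k] assms by simp
  have h: "h \<ge> 1" using assms by (simp add: h_def)
  show ?thesis
  proof (cases "even n")
    case True
    then have n: "n = h + h" by (auto simp: h_def)
    have "1 - h / real n = 1 / 2" using h by (simp add: n field_simps)
    then have "(1 - 1 / real n) ^ h * (1 - 1 / real n) ^ h \<ge> 1 / 2 * (1 / 2)"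
      using b[of h] by (intro mult_mono) auto
    moreover have "(1 - 1 / real n) ^ n = (1 - 1 / real n) ^ h * (1 - 1 / real n) ^ h"
      by (metis n power_add)
    ultimately show ?thesis by linarith
  next
    case False
    then have n: "n = h + (h + 1)" by (auto simp: h_def elim!: oddE)
    have "1 / 5 \<le> (real h + 1) / n * (h / n)"
    proof -
      have "h * h + h \<ge> 2 * 1" using mult_le_mono[OF h h] h by linarith
      then have "real (h * h) + h \<ge> 2" by linarith
      then show ?thesis using h by (simp add: n field_simps)
    qed
    also have "\<dots> = (1 - h / real n) * (1 - (h + 1) / real n)"
      using h by (simp add: n field_simps)
    also have "\<dots> \<le> (1 - 1 / real n) ^ h * (1 - 1 / real n) ^ (h + 1)"
      using b[of h] b[of "h + 1"] h by (intro mult_mono) (auto simp: n)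
    also have "\<dots> = (1 - 1 / real n) ^ n"
      by (metis n power_add)
    finally show ?thesis .
  qed
qed

text \<open>Splitting by the value \<open>x\<close> of \<open>d v\<close> gives the sum of
  \<open>(1 / n) * ((n - x) / n) ^ k\<close>. Ties cost at most a factor 5 against the value
  \<open>1 / (k + 1)\<close> for distinct numbers.\<close>

lemma prob_strict_min_ge:
  assumes n: "nT W \<ge> 2" and v: "v < nT W" and U: "U \<subseteq> {..<nT W}" "v \<notin> U"
  shows "measure_pmf.prob (draws W) {d. \<forall>u\<in>U. d v < d u} \<ge> 1 / (5 * real (card U + 1))"
proof -
  define n where "n = nT W"
  define k where "k = card U"
  define p where "p = pmf_of_set {1..n}"
  have fU: "finite U" using U finite_subset by blast
  have "card (insert v U) \<le> card {..<n}" using U v by (intro card_mono) (auto simp: n_def)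
  then have kn: "k + 1 \<le> n" using U fU by (simp add: k_def)
  have n2: "n \<ge> 2" using n by (simp add: n_def)
  define S where "S x = {d :: nat \<Rightarrow> nat. d v = x \<and> (\<forall>u\<in>U. x < d u)}" for x
  have S: "measure_pmf.prob (draws W) (S x) = 1 / real n * (real (n - x) / real n) ^ k"
    if "x \<in> {1..n}" for x
  proof -
    define B where "B i = (if i = v then {x} else if i \<in> U then {x<..} else UNIV)" for i
    have "S x = Pi {..<n} B"
      using U v by (auto simp: S_def B_def n_def Pi_def split: if_splits)
    then have "measure_pmf.prob (draws W) (S x) = (\<Prod>i<n. measure_pmf.prob p (B i))"
      by (simp add: draws_def measure_Pi_pmf_Pi p_def n_def)
    also have "\<dots> = (\<Prod>i\<in>insert v U. measure_pmf.prob p (B i))"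
      using U v by (intro prod.mono_neutral_right) (auto simp: B_def n_def)
    also have "\<dots> = measure_pmf.prob p {x} * (\<Prod>i\<in>U. measure_pmf.prob p {x<..})"
    proof -
      have "(\<Prod>i\<in>U. measure_pmf.prob p (B i)) = (\<Prod>i\<in>U. measure_pmf.prob p {x<..})"
        using U by (intro prod.cong) (auto simp: B_def)
      then show ?thesis using U fU by (simp add: B_def)
    qed
    also have "measure_pmf.prob p {x} = 1 / real n"
      using that by (simp add: p_def measure_pmf_of_set)
    also have "measure_pmf.prob p {x<..} = real (n - x) / real n"
    proof -
      have "{1..n} \<inter> {x<..} = {x<..n}" using that by auto
      then show ?thesis using n2 by (simp add: p_def measure_pmf_of_set)
    qed
    finally show ?thesis by (simp add: k_def)
  qed
  have "1 / (5 * real (k + 1)) \<le> (1 - 1 / real n) ^ n / Suc k"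
    using divide_right_mono[OF one_minus_inverse_power_ge[OF n2], of "Suc k"] by simp
  also have "\<dots> \<le> (1 - 1 / real n) ^ Suc k / Suc k"
    using kn n2 by (intro divide_right_mono power_decreasing) auto
  also have "(1 - 1 / real n) ^ Suc k = real (n - 1) ^ Suc k / real n ^ Suc k"
    using n2 by (subst power_divide[symmetric]) (simp add: field_simps of_nat_diff)
  also have "\<dots> / Suc k = (real (n - 1) ^ Suc k / Suc k) / real n ^ Suc k" by simp
  also have "\<dots> \<le> (\<Sum>y<Suc (n - 1). real y ^ k) / real n ^ Suc k"
    by (intro divide_right_mono sum_power_lower_bound) auto
  also have "Suc (n - 1) = n" using n2 by simp
  also have "(\<Sum>y<n. real y ^ k) = (\<Sum>i<n. real (n - Suc i) ^ k)"
    by (rule sum.nat_diff_reindex[symmetric])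
  also have "\<dots> = (\<Sum>x\<in>{1..n}. real (n - x) ^ k)"
    by (simp add: sum.atLeast1_atMost_eq)
  also have "\<dots> / real n ^ Suc k = (\<Sum>x\<in>{1..n}. measure_pmf.prob (draws W) (S x))"
    by (simp add: S sum_divide_distrib power_divide)
  also have "\<dots> = measure_pmf.prob (draws W) (\<Union>x\<in>{1..n}. S x)"
    by (intro measure_pmf.finite_measure_finite_Union[symmetric])
       (auto simp: disjoint_family_on_def S_def)
  also have "\<dots> \<le> measure_pmf.prob (draws W) {d. \<forall>u\<in>U. d v < d u}"
    by (intro measure_pmf.finite_measure_mono) (auto simp: S_def)
  finally show ?thesis by (simp add: k_def)
qed

section \<open>The waiting time of a single transaction\<close>

text \<open>Makes the truncated difference \<open>tau W u - snd a u\<close> in the debt a positive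
  remaining time.\<close>

definition prog_bounded :: "workload \<Rightarrow> run_state \<Rightarrow> bool" where
  "prog_bounded W a \<longleftrightarrow> (\<forall>i. live W a i \<longrightarrow> snd a i < tau W i)"

text \<open>Once settled, \<open>v\<close> is never blocked again: a running transaction runs
  through, and vanished conflicts do not return.\<close>

definition settled :: "workload \<Rightarrow> run_state \<Rightarrow> nat \<Rightarrow> bool" where
  "settled W a v \<longleftrightarrow> \<not> live W a v \<or> snd a v > 0 \<or>
     (\<forall>u. live W a u \<and> u \<noteq> v \<longrightarrow> \<not> conflict W u v)"

definition live_prob :: "workload \<Rightarrow> nat \<Rightarrow> nat \<Rightarrow> run_state \<Rightarrow> real" where
  "live_prob W t v = run_expectation W t (\<lambda>a. of_bool (live W a v))"

definition rivals :: "workload \<Rightarrow> run_state \<Rightarrow> nat \<Rightarrow> nat set" where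
  "rivals W a v = {u. live W a u \<and> u \<noteq> v \<and> conflict W u v \<and> key W u = key W v}"

text \<open>Each step in which some rival of \<open>v\<close> is running decreases the debt of \<open>v\<close>, and each other step
  gives \<open>v\<close> a fresh chance to draw the least number.\<close>
definition debt :: "workload \<Rightarrow> run_state \<Rightarrow> nat \<Rightarrow> nat" where
  "debt W a v = (\<Sum>u\<in>rivals W a v. tau W u - snd a u)"

definition undominated :: "workload \<Rightarrow> run_state \<Rightarrow> nat \<Rightarrow> bool" where
  "undominated W a v \<longleftrightarrow>
     (\<forall>u. live W a u \<and> u \<noteq> v \<and> conflict W u v \<longrightarrow> \<not> key_lt (key W u) (key W v))"

lemma live_prob_0: "live_prob W 0 v a = of_bool (live W a v)"
  and live_prob_Suc: "live_prob W (Suc t) v a = step_expectation W (live_prob W t v) a"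
  by (auto simp: live_prob_def)

lemma live_run_step:
  "live W (run_step W a d) i \<longleftrightarrow>
     live W a i \<and> (blocked W a d i \<or> snd a i + 1 < tau W i)"
  by (auto simp: live_def run_step_def)

lemma prog_run_step:
  "snd (run_step W a d) i = (if live W a i \<and> \<not> blocked W a d i then snd a i + 1 else 0)"
  by (simp add: run_step_def)

lemma live_prob_le_1:
  assumes "nT W > 0" shows "live_prob W t v a \<le> 1"
proof -
  have "live_prob W t v a \<le> run_expectation W t (\<lambda>_. 1) a"
    unfolding live_prob_def by (rule run_expectation_mono[where Q = "\<lambda>_. True"]) (use assms in auto)
  then show ?thesis by simp
qed

lemma blocked_prog: "blocked W a d i \<Longrightarrow> snd a i = 0"
  by (simp add: blocked_def)

lemma prog_bounded_step: "prog_bounded W a \<Longrightarrow> prog_bounded W (run_step W a d)"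
  unfolding prog_bounded_def live_run_step prog_run_step
  using blocked_prog by fastforce

lemma settled_not_blocked: "settled W a v \<Longrightarrow> \<not> blocked W a d v"
  by (auto simp: settled_def blocked_def)

lemma not_blocked_settled_step: "\<not> blocked W a d v \<Longrightarrow> settled W (run_step W a d) v"
  by (auto simp: settled_def live_run_step prog_run_step)

lemma settled_step: "settled W a v \<Longrightarrow> settled W (run_step W a d) v"
  by (intro not_blocked_settled_step settled_not_blocked)

lemma undominated_step: "undominated W a v \<Longrightarrow> undominated W (run_step W a d) v"
  by (auto simp: undominated_def live_run_step)

text \<open>A settled live transaction advances in every step, so it surely commits within its
  remaining time.\<close>

lemma live_prob_settled:
  assumes "prog_bounded W a" "settled W a v" "live W a v \<Longrightarrow> tau W v \<le> snd a v + t"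
  shows "live_prob W t v a = 0"
  using assms
proof (induction t arbitrary: a)
  case 0
  then show ?case by (force simp: live_prob_0 prog_bounded_def)
next
  case (Suc t)
  have "live_prob W t v (run_step W a d) = 0" for d
  proof (rule Suc.IH)
    show "tau W v \<le> snd (run_step W a d) v + t" if "live W (run_step W a d) v"
      using that Suc.prems(3) settled_not_blocked[OF Suc.prems(2), of d]
      by (auto simp: live_run_step prog_run_step)
  qed (use Suc.prems in \<open>auto intro: prog_bounded_step settled_step\<close>)
  then show ?case by (simp add: live_prob_Suc step_expectation_def)
qed

lemma finite_rivals [simp]: "finite (rivals W a v)"
  by (rule finite_subset[of _ "{..<nT W}"]) (auto simp: rivals_def live_def)

lemma rivals_step: "rivals W (run_step W a d) v \<subseteq> rivals W a v"
  by (auto simp: rivals_def live_run_step)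

lemma debt_step:
  assumes "prog_bounded W a"
  shows "debt W (run_step W a d) v \<le> debt W a v"
    and "u \<in> rivals W a v \<Longrightarrow> snd a u > 0 \<Longrightarrow> debt W (run_step W a d) v < debt W a v"
proof -
  let ?a = "run_step W a d"
  \<comment> \<open>Rivals that leave contribute 0, so both debts are sums over the old rivals and
    compare termwise.\<close>
  define g where "g u = (if u \<in> rivals W ?a v then tau W u - snd ?a u else 0)" for u
  have g: "debt W ?a v = (\<Sum>u\<in>rivals W a v. g u)"
    unfolding debt_def g_def using rivals_step[of W a d v]
    by (intro sum.mono_neutral_cong_left) auto
  have le: "g u \<le> tau W u - snd a u" if "u \<in> rivals W a v" for u
    using that blocked_prog[of W a d u] by (auto simp: g_def prog_run_step rivals_def)
  show "debt W ?a v \<le> debt W a v"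
    unfolding g unfolding debt_def by (intro sum_mono le)
  assume u: "u \<in> rivals W a v" "snd a u > 0"
  then have "g u < tau W u - snd a u"
    using blocked_prog[of W a d u] assms
    by (auto simp: g_def prog_run_step rivals_def prog_bounded_def)
  then show "debt W ?a v < debt W a v"
    unfolding g unfolding debt_def using u le by (intro sum_strict_mono_ex1) auto
qed

text \<open>\<open>tau W v\<close> steps are reserved for the final run. Of the other
  \<open>t\<close>, those with a running rival are paid for by the debt, and each further one fails
  to start the final run with probability at most \<open>1 - 1 / (5 * m)\<close>.\<close>

lemma live_prob_le_debt:
  assumes n: "nT W \<ge> 2"
    and "prog_bounded W a" "undominated W a v" "card (rivals W a v) < m"
  shows "live_prob W (t + tau W v) v a \<le> (1 - 1 / (5 * real m)) ^ (t - debt W a v)"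
  using assms(2-)
proof (induction t arbitrary: a)
  case 0
  then show ?case using live_prob_le_1[of W] n by simp
next
  case (Suc t)
  note prems = Suc.prems
  define q where "q = 1 - 1 / (5 * real m)"
  have q: "0 \<le> q" "q \<le> 1" using prems(3) by (auto simp: q_def field_simps)
  have IH: "live_prob W (t + tau W v) v (run_step W a d) \<le>
              q ^ (t - debt W (run_step W a d) v)" for d
    unfolding q_def
  proof (rule Suc.IH)
    show "card (rivals W (run_step W a d) v) < m"
      using card_mono[OF finite_rivals rivals_step[of W a d v]] prems(3) by simp
  qed (use prems in \<open>auto intro: prog_bounded_step undominated_step\<close>)
  show ?case
  proof (cases "settled W a v")
    case True
    then have "live_prob W (Suc t + tau W v) v a = 0"
      using prems by (intro live_prob_settled) auto
    then show ?thesis using q by (simp add: q_def)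
  next
    case False
    then have v: "live W a v" "snd a v = 0" by (auto simp: settled_def)
    show ?thesis
    proof (cases "\<exists>u\<in>rivals W a v. snd a u > 0")
      case True
      have "live_prob W (t + tau W v) v (run_step W a d) \<le> q ^ (Suc t - debt W a v)" for d
      proof -
        \<comment> \<open>The lost step also removes at least one unit of debt, so the exponent does
          not drop.\<close>
        have "debt W (run_step W a d) v < debt W a v"
          using True debt_step(2)[OF prems(1)] by blast
        then have "q ^ (t - debt W (run_step W a d) v) \<le> q ^ (Suc t - debt W a v)"
          using q by (intro power_decreasing) auto
        with IH[of d] show ?thesis by linarith
      qed
      then have "step_expectation W (live_prob W (t + tau W v) v) a \<le>
                 step_expectation W (\<lambda>_. q ^ (Suc t - debt W a v)) a"
        using n by (intro step_expectation_mono) auto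
      then show ?thesis by (simp add: live_prob_Suc q_def)
    next
      case False
      \<comment> \<open>No rival is running here, so on \<open>G\<close> the final run starts and
        the reserved steps suffice.\<close>
      define G where "G = {d :: nat \<Rightarrow> nat. \<forall>u\<in>rivals W a v. d v < d u}"
      have "live_prob W (t + tau W v) v (run_step W a d) \<le>
              q ^ (t - debt W a v) * indicator (- G) d" for d
      proof (cases "d \<in> G")
        case True
        have "\<not> blocked W a d v"
        proof
          assume "blocked W a d v"
          then obtain u where u: "live W a u" "u \<noteq> v" "conflict W u v"
            "key_lt (key W u) (key W v) \<or>
             key W u = key W v \<and> (snd a u > 0 \<or> d u < d v \<or> d u = d v \<and> u < v)"
            by (auto simp: blocked_def)
          with prems(2) have "key W u = key W v" "snd a u > 0 \<or> d u < d v \<or> d u = d v \<and> u < v"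
            by (auto simp: undominated_def)
          moreover from this u have "u \<in> rivals W a v" by (auto simp: rivals_def)
          ultimately show False using True False by (force simp: G_def)
        qed
        then have "live_prob W (t + tau W v) v (run_step W a d) = 0"
          using prems by (intro live_prob_settled prog_bounded_step not_blocked_settled_step) auto
        then show ?thesis using q by simp
      next
        case d: False
        have "q ^ (t - debt W (run_step W a d) v) \<le> q ^ (t - debt W a v)"
          using q debt_step(1)[OF prems(1), of d v] by (intro power_decreasing) auto
        with IH[of d] d show ?thesis by simp
      qed
      then have "step_expectation W (live_prob W (t + tau W v) v) a \<le>
        measure_pmf.expectation (draws W) (\<lambda>d. q ^ (t - debt W a v) * indicator (- G) d)"
        using n unfolding step_expectation_def by (intro integral_mono integrable_draws) auto
      also have "\<dots> = q ^ (t - debt W a v) * measure_pmf.prob (draws W) (- G)"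
        by simp
      also have "measure_pmf.prob (draws W) (- G) = 1 - measure_pmf.prob (draws W) G"
        using measure_pmf.prob_compl[of G "draws W"] by (simp add: Compl_eq_Diff_UNIV)
      also have "q ^ (t - debt W a v) * (1 - measure_pmf.prob (draws W) G) \<le>
                 q ^ (t - debt W a v) * q"
      proof (intro mult_left_mono)
        have "1 / (5 * real m) \<le> 1 / (5 * real (card (rivals W a v) + 1))"
          using prems(3) by (intro divide_left_mono) auto
        also have "\<dots> \<le> measure_pmf.prob (draws W) G"
          unfolding G_def using n v by (intro prob_strict_min_ge) (auto simp: rivals_def live_def)
        finally show "1 - measure_pmf.prob (draws W) G \<le> q" by (simp add: q_def)
      qed (use q in auto)
      also have "\<dots> = q ^ Suc (t - debt W a v)" by simp
      \<comment> \<open>The exponents agree unless the debt exceeds \<open>t\<close>, where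
        truncation makes them 1 and 0.\<close>
      also have "\<dots> \<le> q ^ (Suc t - debt W a v)"
        using q by (intro power_decreasing) auto
      finally show ?thesis by (simp add: live_prob_Suc q_def)
    qed
  qed
qed

text \<open>The budget: debt at most \<open>(m - 1) * (L - 1)\<close>, \<open>5 * m\<close> free
  attempts and a final run of at most \<open>L - 1\<close> steps; \<open>L + 4 <= 3 * L\<close>
  holds as \<open>L\<close> is at least 2. All attempts fail with probability at most
  \<open>exp (- 1)\<close>.\<close>

lemma live_prob_window:
  assumes n: "nT W \<ge> 2"
    and a: "prog_bounded W a" "undominated W a v" "card (rivals W a v) < m"
    and L: "L \<ge> 2" "tau W v < L" "\<And>u. u \<in> rivals W a v \<Longrightarrow> tau W u < L"
  shows "live_prob W (3 * m * L) v a \<le> 2 / 5"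
proof -
  define q where "q = 1 - 1 / (5 * real m)"
  have m: "m > 0" using a(3) by simp
  have q: "0 \<le> q" "q \<le> 1" using m by (auto simp: q_def field_simps)
  have "debt W a v \<le> (\<Sum>u\<in>rivals W a v. L - 1)"
    unfolding debt_def using L(3) by (intro sum_mono) fastforce
  also have "\<dots> = card (rivals W a v) * (L - 1)" by simp
  also have "\<dots> \<le> (m - 1) * (L - 1)" using a(3) by (intro mult_le_mono1) linarith
  finally have "debt W a v + 5 * m + tau W v \<le> (m - 1) * (L - 1) + 5 * m + (L - 1)"
    using L by linarith
  also have "\<dots> = m * (L - 1) + 5 * m" using m by (cases m) auto
  also have "\<dots> \<le> 3 * m * L"
  proof -
    obtain k where "L = k + 2" using L(1) by (metis add.commute le_Suc_ex)
    then show ?thesis by (simp add: algebra_simps)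
  qed
  finally have le: "debt W a v + 5 * m + tau W v \<le> 3 * m * L" .
  define t where "t = 3 * m * L - tau W v"
  have t: "t + tau W v = 3 * m * L" "5 * m \<le> t - debt W a v" using le by (auto simp: t_def)
  have "live_prob W (t + tau W v) v a \<le> q ^ (t - debt W a v)"
    unfolding q_def by (rule live_prob_le_debt) fact+
  also have "\<dots> \<le> q ^ (5 * m)" using q t by (intro power_decreasing)
  also have "\<dots> \<le> exp (- 1 / (5 * real m)) ^ (5 * m)"
    using q exp_ge_add_one_self[of "- 1 / (5 * real m)"]
    by (intro power_mono) (auto simp: q_def)
  also have "\<dots> = exp (- 1)" using m by (simp flip: exp_of_nat_mult)
  also have "\<dots> \<le> 2 / 5"
    using exp_lower_Taylor_quadratic[of "1::real"] by (simp add: exp_minus field_simps)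
  finally show ?thesis using t by simp
qed

section \<open>Progress of a subgroup\<close>

definition subgroup :: "workload \<Rightarrow> nat \<times> nat \<Rightarrow> nat set" where
  "subgroup W p = {v. v < nT W \<and> writing W v \<and> key W v = p}"

text \<open>Writers of one resource conflict pairwise, so this is the size of a clique as well as a
  factor in the out-degree bound.\<close>

definition write_load :: "workload \<Rightarrow> nat \<times> nat \<Rightarrow> nat" where
  "write_load W p = Max ((\<lambda>r. card {v \<in> subgroup W p. r \<in> wr W v}) ` {..<nR W})"

text \<open>The factor \<open>8 * 2 ^ snd p\<close> is four times the strict upper bound
  \<open>2 * 2 ^ snd p\<close> on \<open>lam\<close> in the subgroup.\<close>

definition width :: "workload \<Rightarrow> nat \<times> nat \<Rightarrow> nat" where
  "width W p = min (8 * 2 ^ snd p * write_load W p) (card (subgroup W p))"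

definition time_cap :: "workload \<Rightarrow> nat \<times> nat \<Rightarrow> nat" where
  "time_cap W p = 2 ^ (fst p + 1) * tau_min W"

definition lower_done :: "workload \<Rightarrow> nat \<times> nat \<Rightarrow> run_state \<Rightarrow> bool" where
  "lower_done W p a \<longleftrightarrow> (\<forall>u. live W a u \<and> writing W u \<longrightarrow> \<not> key_lt (key W u) p)"

lemma finite_subgroup [simp]: "finite (subgroup W p)"
  by (simp add: subgroup_def)

lemma lower_done_step: "lower_done W p a \<Longrightarrow> lower_done W p (run_step W a d)"
  by (auto simp: lower_done_def live_run_step)

section \<open>Bounds for group and subgroup indices\<close>

lemma tau_min_pos: "valid_workload W \<Longrightarrow> tau_min W \<ge> 1"
  unfolding tau_min_def valid_workload_def by (subst Min_ge_iff) auto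

lemma tau_min_le: "v < nT W \<Longrightarrow> tau_min W \<le> tau W v"
  unfolding tau_min_def by (intro Min_le) auto

lemma tau_max_ge: "v < nT W \<Longrightarrow> tau W v \<le> tau_max W"
  unfolding tau_max_def by (intro Max_ge) auto

lemma floor_log2_bounds:
  assumes "x \<ge> (1::real)"
  shows "2 ^ nat \<lfloor>log 2 x\<rfloor> \<le> x" and "x < 2 ^ (nat \<lfloor>log 2 x\<rfloor> + 1)"
proof -
  define k where "k = nat \<lfloor>log 2 x\<rfloor>"
  have "0 \<le> log 2 x" using assms by simp
  then have k: "real k \<le> log 2 x" "log 2 x < real (k + 1)" unfolding k_def by linarith+
  have x: "2 powr log 2 x = x" using assms by simp
  have "2 powr real k \<le> x" using k(1) x by (metis one_le_numeral powr_mono)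
  then show "2 ^ nat \<lfloor>log 2 x\<rfloor> \<le> x" by (simp add: powr_realpow flip: k_def)
  have "x < 2 powr real (k + 1)" using k(2) x by (metis one_less_numeral_iff powr_less_mono semiring_norm(76))
  also have "\<dots> = 2 ^ (k + 1)" by (rule powr_realpow) simp
  finally show "x < 2 ^ (nat \<lfloor>log 2 x\<rfloor> + 1)" by (simp flip: k_def)
qed

lemma grp_idx_bounds:
  assumes "valid_workload W" "v < nT W"
  shows "2 ^ grp_idx W v * tau_min W \<le> tau W v" and "tau W v < 2 ^ (grp_idx W v + 1) * tau_min W"
proof -
  define x where "x = real (tau W v) / real (tau_min W)"
  have m: "tau_min W > 0" using tau_min_pos[OF assms(1)] by simp
  have x: "x \<ge> 1" using m tau_min_le[OF assms(2)] by (simp add: x_def)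
  have g: "grp_idx W v = nat \<lfloor>log 2 x\<rfloor>" by (simp add: grp_idx_def x_def)
  have "real (2 ^ grp_idx W v * tau_min W) \<le> real (tau W v)"
    using floor_log2_bounds(1)[OF x] m unfolding g by (simp add: x_def pos_le_divide_eq)
  then show "2 ^ grp_idx W v * tau_min W \<le> tau W v" by (simp only: of_nat_le_iff)
  have "real (tau W v) < real (2 ^ (grp_idx W v + 1) * tau_min W)"
    using floor_log2_bounds(2)[OF x] m unfolding g by (simp add: x_def pos_divide_less_eq)
  then show "tau W v < 2 ^ (grp_idx W v + 1) * tau_min W" by (simp only: of_nat_less_iff)
qed

lemma grp_idx_less_ell:
  assumes "valid_workload W" "v < nT W"
  shows "grp_idx W v < ell W"
proof -
  have m: "tau_min W > 0" using tau_min_pos[OF assms(1)] by simp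
  have "0 < real (tau W v) / real (tau_min W)"
    using m tau_min_le[OF assms(2)] by (intro divide_pos_pos) auto
  moreover have "real (tau W v) / real (tau_min W) \<le> real (tau_max W) / real (tau_min W)"
    using tau_max_ge[OF assms(2)] by (intro divide_right_mono) auto
  ultimately have "log 2 (real (tau W v) / real (tau_min W)) \<le> log 2 (real (tau_max W) / real (tau_min W))"
    by simp
  then have "\<lfloor>log 2 (real (tau W v) / real (tau_min W))\<rfloor> \<le>
        \<lceil>log 2 (real (tau_max W) / real (tau_min W))\<rceil>" by linarith
  then show ?thesis unfolding grp_idx_def ell_def by (simp add: nat_mono le_imp_less_Suc)
qed

lemma lam_bounds:
  assumes "valid_workload W" "v < nT W"
  shows "1 \<le> lam W v" "lam W v \<le> nR W" "finite (res W v)" "res W v \<subseteq> {0..<nR W}"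
proof -
  have r: "res W v \<subseteq> {0..<nR W}" "res W v \<noteq> {}"
    using assms by (auto simp: valid_workload_def res_def)
  then show f: "finite (res W v)" using finite_subset by blast
  show "res W v \<subseteq> {0..<nR W}" by fact
  show "1 \<le> lam W v" using r f by (simp add: lam_def Suc_le_eq card_gt_0_iff)
  show "lam W v \<le> nR W" using card_mono[OF _ r(1)] by (simp add: lam_def)
qed

text \<open>The crude third bound, from \<open>j < 2 ^ j\<close>, allows an enumeration with
  \<open>nR W\<close> subgroups per group; the extra ones are empty and have width 0.\<close>

lemma sub_idx_bounds:
  assumes "valid_workload W" "v < nT W"
  shows "2 ^ sub_idx W v \<le> lam W v" and "lam W v < 2 ^ (sub_idx W v + 1)" and "sub_idx W v < nR W"
proof -
  have x: "real (lam W v) \<ge> 1" using lam_bounds[OF assms] by simp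
  have "real (2 ^ sub_idx W v) \<le> real (lam W v)"
    using floor_log2_bounds(1)[OF x] unfolding sub_idx_def by simp
  then show 1: "2 ^ sub_idx W v \<le> lam W v" by (simp only: of_nat_le_iff)
  have "real (lam W v) < real (2 ^ (sub_idx W v + 1))"
    using floor_log2_bounds(2)[OF x] unfolding sub_idx_def by simp
  then show "lam W v < 2 ^ (sub_idx W v + 1)" by (simp only: of_nat_less_iff)
  show "sub_idx W v < nR W"
    using 1 lam_bounds(2)[OF assms] less_exp[of "sub_idx W v"] by linarith
qed

lemma subgroup_key:
  assumes "v \<in> subgroup W p"
  shows "fst p = grp_idx W v" "snd p = sub_idx W v"
  using assms by (auto simp: subgroup_def key_def)

lemma tau_less_time_cap:
  assumes "valid_workload W" "v \<in> subgroup W p"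
  shows "tau W v < time_cap W p"
  using grp_idx_bounds(2)[OF assms(1), of v] subgroup_key[OF assms(2)] assms(2)
  by (simp add: time_cap_def subgroup_def)

lemma card_writers_le_load:
  "r < nR W \<Longrightarrow> card {v \<in> subgroup W p. r \<in> wr W v} \<le> write_load W p"
  unfolding write_load_def by (intro Max_ge) auto

section \<open>Degrees in the conflict graph of a subgroup\<close>

definition closed_nbhd :: "workload \<Rightarrow> nat set \<Rightarrow> nat \<Rightarrow> nat set" where
  "closed_nbhd W V v = {u \<in> V. conflict W u v}"

text \<open>The out-degree bound: \<open>v\<close> touches fewer than \<open>2 * 2 ^ snd p\<close>
  resources, each with at most \<open>write_load W p\<close> writers.\<close>

lemma card_writers_meeting:
  assumes "valid_workload W" "V \<subseteq> subgroup W p" "v \<in> V"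
  shows "card {u \<in> V. wr W u \<inter> res W v \<noteq> {}} \<le> 2 * 2 ^ snd p * write_load W p"
proof -
  have v: "v < nT W" "v \<in> subgroup W p" using assms by (auto simp: subgroup_def)
  have "card {u \<in> V. wr W u \<inter> res W v \<noteq> {}} \<le> card (\<Union>r\<in>res W v. {u \<in> subgroup W p. r \<in> wr W u})"
    using assms(2) lam_bounds(3)[OF assms(1) v(1)] by (intro card_mono) auto
  also have "\<dots> \<le> (\<Sum>r\<in>res W v. card {u \<in> subgroup W p. r \<in> wr W u})"
    using lam_bounds(3)[OF assms(1) v(1)] by (rule card_UN_le)
  also have "\<dots> \<le> (\<Sum>r\<in>res W v. write_load W p)"
    using lam_bounds(4)[OF assms(1) v(1)] by (intro sum_mono card_writers_le_load) auto
  also have "\<dots> = lam W v * write_load W p" by (simp add: lam_def)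
  also have "\<dots> \<le> 2 * 2 ^ snd p * write_load W p"
    using sub_idx_bounds(2)[OF assms(1) v(1)] subgroup_key[OF v(2)] by (intro mult_le_mono1) simp
  finally show ?thesis .
qed

text \<open>Orienting each conflict from a transaction to the writer of a resource it touches bounds
  the out-degrees by \<open>lam\<close> times the write load, although in-degrees, and hence degrees, may be
  as large as the subgroup.\<close>

lemma card_large_nbhd:
  assumes "valid_workload W" "V \<subseteq> subgroup W p"
  shows "2 * card {v \<in> V. card (closed_nbhd W V v) > 8 * 2 ^ snd p * write_load W p} \<le> card V"
proof -
  define D where "D = 2 * 2 ^ snd p * write_load W p"
  define bad where "bad = {v \<in> V. card (closed_nbhd W V v) > 4 * D}"
  have fV: "finite V" using assms(2) finite_subset finite_subgroup by blast
  \<comment> \<open>Averaging: all degrees sum to at most \<open>2 * D * card V\<close>, and each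
    bad vertex has degree at least \<open>4 * D + 1\<close>, a factor that stays positive for
    \<open>D = 0\<close>.\<close>
  have "(4 * D + 1) * card bad = (\<Sum>v\<in>bad. 4 * D + 1)" by simp
  also have "\<dots> \<le> (\<Sum>v\<in>bad. card (closed_nbhd W V v))"
    by (intro sum_mono) (auto simp: bad_def)
  also have "\<dots> \<le> (\<Sum>v\<in>V. card (closed_nbhd W V v))"
    using fV by (intro sum_mono2) (auto simp: bad_def)
  also have "\<dots> \<le> (\<Sum>v\<in>V. card {u \<in> V. wr W u \<inter> res W v \<noteq> {}} + card {u \<in> V. res W u \<inter> wr W v \<noteq> {}})"
  proof (intro sum_mono)
    fix v
    have "closed_nbhd W V v = {u \<in> V. wr W u \<inter> res W v \<noteq> {}} \<union> {u \<in> V. res W u \<inter> wr W v \<noteq> {}}"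
      by (auto simp: closed_nbhd_def conflict_def)
    then show "card (closed_nbhd W V v) \<le>
       card {u \<in> V. wr W u \<inter> res W v \<noteq> {}} + card {u \<in> V. res W u \<inter> wr W v \<noteq> {}}"
      by (simp add: card_Un_le)
  qed
  also have "\<dots> = (\<Sum>v\<in>V. card {u \<in> V. wr W u \<inter> res W v \<noteq> {}}) + (\<Sum>v\<in>V. card {u \<in> V. res W u \<inter> wr W v \<noteq> {}})"
    by (rule sum.distrib)
  \<comment> \<open>In-degrees and out-degrees have the same sum.\<close>
  also have "(\<Sum>v\<in>V. card {u \<in> V. res W u \<inter> wr W v \<noteq> {}}) = (\<Sum>v\<in>V. card {u \<in> V. wr W u \<inter> res W v \<noteq> {}})"
    using sum_multicount_gen[OF fV fV, of "\<lambda>u v. res W u \<inter> wr W v \<noteq> {}"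
        "\<lambda>v. card {u \<in> V. res W u \<inter> wr W v \<noteq> {}}"]
    by (simp add: Int_commute)
  also have "(\<Sum>v\<in>V. card {u \<in> V. wr W u \<inter> res W v \<noteq> {}}) + \<dots> \<le> (\<Sum>v\<in>V. D) + (\<Sum>v\<in>V. D)"
    unfolding D_def by (intro add_mono sum_mono card_writers_meeting assms)
  also have "\<dots> = 2 * D * card V" by (simp add: mult_2 add_mult_distrib mult.commute)
  finally have "(4 * D + 1) * card bad \<le> 2 * D * card V" .
  then have "(4 * D + 1) * (2 * card bad) \<le> (4 * D) * card V" by simp
  also have "\<dots> \<le> (4 * D + 1) * card V" by simp
  finally have "2 * card bad \<le> card V" by (metis add_gr_0 mult_le_cancel1 zero_less_one)
  then show ?thesis by (simp add: bad_def D_def mult.assoc)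
qed

lemma read_only_key: "\<not> writing W u \<Longrightarrow> key W u = (ell W, 0)"
  by (simp add: key_def)

text \<open>At most half of the live transactions are bad and get the trivial bound 1, the others
  get 2/5; the mean is at most \<open>2/5 + 3/5 * 1/2 = 7/10\<close>.\<close>

lemma sum_live_prob_window:
  assumes W: "valid_workload W" "nT W \<ge> 2" and p: "fst p < ell W"
    and a: "prog_bounded W a" "lower_done W p a"
  shows "(\<Sum>v\<in>subgroup W p. live_prob W (3 * width W p * time_cap W p) v a) \<le>
         7 / 10 * (\<Sum>v\<in>subgroup W p. of_bool (live W a v))"
proof -
  define V where "V = {v \<in> subgroup W p. live W a v}"
  define bad where "bad = {v \<in> V. card (closed_nbhd W V v) > 8 * 2 ^ snd p * write_load W p}"
  let ?P = "\<lambda>v. live_prob W (3 * width W p * time_cap W p) v a"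
  have fV: "finite V" by (simp add: V_def)
  \<comment> \<open>The read-only key \<open>(ell W, 0)\<close> lies above \<open>p\<close>, so only
    writing transactions can rival or dominate.\<close>
  have wr: "writing W u" if "key W u = p \<or> key_lt (key W u) p" for u
    using that p read_only_key[of W u] by (cases "writing W u") (auto simp: key_lt_def)
  have good: "?P v \<le> 2 / 5" if v: "v \<in> V" "v \<notin> bad" for v
  proof (rule live_prob_window[OF W(2) a(1)])
    have key: "key W v = p" using v by (auto simp: V_def subgroup_def)
    show "undominated W a v"
      using a(2) wr unfolding undominated_def lower_done_def key by blast
    have riv: "rivals W a v \<subseteq> closed_nbhd W V v"
      using wr unfolding rivals_def key by (auto simp: closed_nbhd_def V_def subgroup_def live_def)
    \<comment> \<open>A writing transaction conflicts with itself; this makes the bound on the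
      rivals strict.\<close>
    have "v \<in> closed_nbhd W V v"
      using v by (auto simp: closed_nbhd_def V_def subgroup_def conflict_def writing_def res_def)
    then have "rivals W a v \<subset> closed_nbhd W V v"
      using riv by (auto simp: rivals_def)
    moreover have "finite (closed_nbhd W V v)" using fV by (simp add: closed_nbhd_def)
    ultimately have "card (rivals W a v) < card (closed_nbhd W V v)"
      by (rule psubset_card_mono[rotated])
    also have "card (closed_nbhd W V v) \<le> width W p"
      unfolding width_def using v
      by (intro min.boundedI card_mono) (auto simp: bad_def closed_nbhd_def V_def)
    finally show "card (rivals W a v) < width W p" .
    show "tau W v < time_cap W p" using v W by (intro tau_less_time_cap) (auto simp: V_def)
    show "tau W u < time_cap W p" if "u \<in> rivals W a v" for u
      using that riv W by (intro tau_less_time_cap) (auto simp: V_def closed_nbhd_def)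
    have "2 * 1 \<le> 2 ^ (fst p + 1) * tau_min W"
      using tau_min_pos[OF W(1)] by (intro mult_le_mono) auto
    then show "2 \<le> time_cap W p" by (simp add: time_cap_def)
  qed
  have "(\<Sum>v\<in>subgroup W p. ?P v) = (\<Sum>v\<in>V. ?P v)"
    using a(1) by (intro sum.mono_neutral_right)
       (auto simp: V_def settled_def intro!: live_prob_settled)
  also have "\<dots> \<le> (\<Sum>v\<in>V. 2 / 5 + 3 / 5 * of_bool (v \<in> bad))"
  proof (intro sum_mono)
    fix v assume "v \<in> V"
    then show "?P v \<le> 2 / 5 + 3 / 5 * of_bool (v \<in> bad)"
      using good[of v] live_prob_le_1[of W _ v a] W by (cases "v \<in> bad") auto
  qed
  also have "\<dots> = 2 / 5 * card V + 3 / 5 * card bad"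
  proof -
    have "(\<Sum>v\<in>V. of_bool (v \<in> bad) :: real) = card (V \<inter> bad)"
      using fV by (simp add: sum.If_cases of_bool_def)
    moreover have "V \<inter> bad = bad" by (auto simp: bad_def)
    ultimately show ?thesis unfolding sum.distrib sum_distrib_left[symmetric] by simp
  qed
  also have "\<dots> \<le> 7 / 10 * card V"
  proof -
    have "2 * card bad \<le> card V"
      unfolding bad_def by (intro card_large_nbhd W) (auto simp: V_def)
    then show ?thesis by linarith
  qed
  also have "real (card V) = (\<Sum>v\<in>subgroup W p. of_bool (live W a v))"
    by (simp add: V_def of_bool_def sum.If_cases Int_def)
  finally show ?thesis .
qed

text \<open>Both state conditions persist, so the one-window bound applies to the state reached
  after \<open>k\<close> windows, and linearity of expectation iterates it.\<close>

lemma sum_live_prob_windows: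
  assumes W: "valid_workload W" "nT W \<ge> 2" and p: "fst p < ell W"
    and a: "prog_bounded W a" "lower_done W p a"
  shows "(\<Sum>v\<in>subgroup W p. live_prob W (k * (3 * width W p * time_cap W p)) v a) \<le>
         (7 / 10) ^ k * card (subgroup W p)"
proof (induction k)
  case 0
  have "(\<Sum>v\<in>subgroup W p. of_bool (live W a v) :: real) \<le> (\<Sum>v\<in>subgroup W p. 1)"
    by (intro sum_mono) auto
  then show ?case by (simp add: live_prob_0)
next
  case (Suc k)
  let ?w = "3 * width W p * time_cap W p"
  have n: "nT W > 0" using W by simp
  have "(\<Sum>v\<in>subgroup W p. live_prob W (Suc k * ?w) v a) =
        (\<Sum>v\<in>subgroup W p. run_expectation W (k * ?w) (live_prob W ?w v) a)"
    unfolding live_prob_def run_expectation_add[symmetric] by (simp add: add.commute)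
  also have "\<dots> = run_expectation W (k * ?w) (\<lambda>a. \<Sum>v\<in>subgroup W p. live_prob W ?w v a) a"
    by (rule run_expectation_sum[OF n, symmetric])
  also have "\<dots> \<le> run_expectation W (k * ?w)
                    (\<lambda>a. 7 / 10 * (\<Sum>v\<in>subgroup W p. of_bool (live W a v))) a"
    using sum_live_prob_window[OF W p] a
    by (intro run_expectation_mono[OF n, where Q = "\<lambda>a. prog_bounded W a \<and> lower_done W p a"])
       (blast intro: prog_bounded_step lower_done_step)+
  also have "\<dots> = 7 / 10 * (\<Sum>v\<in>subgroup W p. live_prob W (k * ?w) v a)"
    unfolding run_expectation_mult run_expectation_sum[OF n] live_prob_def ..
  also have "\<dots> \<le> 7 / 10 * ((7 / 10) ^ k * card (subgroup W p))"
    by (intro mult_left_mono Suc.IH) auto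
  finally show ?case by simp
qed

section \<open>Processing the subgroups in order\<close>

text \<open>Lexicographic enumeration of the subgroups; the index \<open>ell W * nR W\<close> yields \<open>(ell W, 0)\<close>, the key
  of the read-only transactions.\<close>
definition sub_key :: "workload \<Rightarrow> nat \<Rightarrow> nat \<times> nat" where
  "sub_key W q = (q div nR W, q mod nR W)"

definition window_count :: "workload \<Rightarrow> nat" where
  "window_count W = nat \<lceil>7 * ln (real (nT W))\<rceil>"

text \<open>The phases have deterministic lengths and belong to the analysis alone.\<close>

definition phase_start :: "workload \<Rightarrow> nat \<Rightarrow> nat" where
  "phase_start W q =
     (\<Sum>r<q. window_count W * (3 * width W (sub_key W r) * time_cap W (sub_key W r)))"

text \<open>Two-digit numbers in base \<open>K\<close> are ordered lexicographically.\<close>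

lemma key_lt_div_mod_iff:
  assumes "y < K"
  shows "key_lt (x, y) (q div K, q mod K) \<longleftrightarrow> x * K + y < q"
proof -
  have q: "q div K * K + q mod K = q" "q mod K < K" using assms by simp_all
  consider "x < q div K" | "x = q div K" | "q div K < x" by linarith
  then show ?thesis
  proof cases
    case 1
    then have "Suc x * K \<le> q div K * K" by (intro mult_le_mono1) simp
    then have "x * K + y < q" unfolding mult_Suc using assms q(1) by linarith
    then show ?thesis using 1 by (simp add: key_lt_def)
  next
    case 2
    then have "x * K + y < q \<longleftrightarrow> y < q mod K" using q(1) by (metis nat_add_left_cancel_less)
    then show ?thesis using 2 by (simp add: key_lt_def)
  next
    case 3
    then have "Suc (q div K) * K \<le> x * K" by (intro mult_le_mono1) simp
    then have "\<not> x * K + y < q" unfolding mult_Suc using q by linarith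
    then show ?thesis using 3 by (simp add: key_lt_def)
  qed
qed

text \<open>A new failure after phase \<open>q\<close> can thus only come from subgroup
  \<open>q\<close>.\<close>

lemma key_lt_sub_key_Suc:
  assumes W: "valid_workload W" and u: "u < nT W" "writing W u"
    and lt: "key_lt (key W u) (sub_key W (Suc q))"
  shows "key_lt (key W u) (sub_key W q) \<or> key W u = sub_key W q"
proof -
  have y: "sub_idx W u < nR W" using sub_idx_bounds(3) W u by blast
  have key: "key W u = (grp_idx W u, sub_idx W u)" using u by (simp add: key_def)
  have "grp_idx W u * nR W + sub_idx W u < Suc q"
    using lt key_lt_div_mod_iff[OF y] by (simp add: key sub_key_def)
  then consider "grp_idx W u * nR W + sub_idx W u < q" | "grp_idx W u * nR W + sub_idx W u = q"
    by linarith
  then show ?thesis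
  proof cases
    case 1
    then show ?thesis using key_lt_div_mod_iff[OF y] by (simp add: key sub_key_def)
  next
    case 2
    then have "sub_key W q = key W u" using y by (auto simp: key sub_key_def)
    then show ?thesis by simp
  qed
qed

lemma nR_pos:
  assumes "valid_workload W" shows "nR W > 0"
  using assms lam_bounds[OF assms, of 0] by (auto simp: valid_workload_def)

text \<open>As 7/10 is at most \<open>exp (- 3 / 10)\<close>, \<open>7 * ln n\<close> windows give
  the exponent \<open>- 2.1 * ln n\<close>.\<close>

lemma window_count_power:
  assumes "nT W \<ge> 2"
  shows "(7 / 10) ^ window_count W \<le> 1 / real (nT W) ^ 2"
proof -
  let ?n = "real (nT W)"
  have ln: "ln ?n \<ge> 0" using assms by simp
  have k: "real (window_count W) \<ge> 7 * ln ?n" unfolding window_count_def by linarith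
  have "(7 / 10 :: real) ^ window_count W \<le> exp (- 3 / 10) ^ window_count W"
    using exp_ge_add_one_self[of "- 3 / 10"] by (intro power_mono) auto
  also have "\<dots> = exp (- (3 / 10) * window_count W)" by (simp flip: exp_of_nat_mult add: mult.commute)
  also have "\<dots> \<le> exp (- (2 * ln ?n))" using k ln by simp
  also have "\<dots> = 1 / exp (ln ?n) ^ 2" by (simp add: exp_minus exp_of_nat_mult[of 2, simplified] field_simps)
  also have "exp (ln ?n) = ?n" using assms by simp
  finally show ?thesis .
qed

text \<open>A union bound over the phases: an earlier failure is already counted, and otherwise
  phase \<open>q\<close> adds at most its subgroup size divided by \<open>n ^ 2\<close>.\<close>

lemma prob_not_lower_done:
  assumes W: "valid_workload W" "nT W \<ge> 2" and q: "q \<le> ell W * nR W"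
  shows "run_expectation W (phase_start W q)
           (\<lambda>a. of_bool (\<not> lower_done W (sub_key W q) a)) run_init \<le>
         (\<Sum>r<q. card (subgroup W (sub_key W r))) / real (nT W) ^ 2"
  using q
proof (induction q)
  case 0
  have "lower_done W (sub_key W 0) a" for a
    by (simp add: lower_done_def sub_key_def key_lt_def)
  then show ?case by simp
next
  case (Suc q)
  let ?p = "sub_key W q"
  let ?len = "window_count W * (3 * width W ?p * time_cap W ?p)"
  let ?bad = "\<lambda>q a. of_bool (\<not> lower_done W (sub_key W q) a) :: real"
  let ?err = "card (subgroup W ?p) / real (nT W) ^ 2"
  have n: "nT W > 0" using W by simp
  have p: "fst ?p < ell W"
    using Suc.prems nR_pos[OF W(1)] by (simp add: sub_key_def less_mult_imp_div_less)
  have step: "run_expectation W ?len (?bad (Suc q)) a \<le> ?bad q a + ?err"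
    if a: "prog_bounded W a" for a
  proof (cases "lower_done W ?p a")
    case True
    \<comment> \<open>Markov's inequality for a count: a failure leaves at least one live
      transaction in the subgroup.\<close>
    have "run_expectation W ?len (?bad (Suc q)) a \<le>
          run_expectation W ?len (\<lambda>a. \<Sum>v\<in>subgroup W ?p. of_bool (live W a v)) a"
    proof (rule run_expectation_mono[OF n, where Q = "lower_done W ?p"])
      fix a assume a: "lower_done W ?p a"
      show "?bad (Suc q) a \<le> (\<Sum>v\<in>subgroup W ?p. of_bool (live W a v))"
      proof (cases "lower_done W (sub_key W (Suc q)) a")
        case False
        then obtain u where u: "live W a u" "writing W u" "key_lt (key W u) (sub_key W (Suc q))"
          by (auto simp: lower_done_def)
        then have "u \<in> subgroup W ?p"
          using key_lt_sub_key_Suc[OF W(1), of u q] a by (auto simp: lower_done_def subgroup_def live_def)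
        then have "of_bool (live W a u) \<le> (\<Sum>v\<in>subgroup W ?p. of_bool (live W a v) :: real)"
          by (intro member_le_sum) auto
        then show ?thesis using u False by simp
      qed (auto intro: sum_nonneg)
    qed (use True in \<open>auto intro: lower_done_step\<close>)
    also have "\<dots> = (\<Sum>v\<in>subgroup W ?p. live_prob W ?len v a)"
      unfolding live_prob_def by (rule run_expectation_sum[OF n])
    also have "\<dots> \<le> (7 / 10) ^ window_count W * card (subgroup W ?p)"
      by (rule sum_live_prob_windows[OF W p a True])
    also have "\<dots> \<le> 1 / real (nT W) ^ 2 * card (subgroup W ?p)"
      by (intro mult_right_mono window_count_power W) auto
    finally show ?thesis using True by simp
  next
    case False
    have "run_expectation W ?len (?bad (Suc q)) a \<le> run_expectation W ?len (\<lambda>_. 1) a"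
      by (rule run_expectation_mono[OF n, where Q = "\<lambda>_. True"]) auto
    moreover have "0 \<le> ?err" by simp
    moreover have "?bad q a = 1" using False by simp
    ultimately show ?thesis unfolding run_expectation_const by linarith
  qed
  have init: "prog_bounded W run_init"
    using W by (force simp: prog_bounded_def run_init_def valid_workload_def live_def)
  have "run_expectation W (phase_start W (Suc q)) (?bad (Suc q)) run_init =
        run_expectation W (phase_start W q) (run_expectation W ?len (?bad (Suc q))) run_init"
    unfolding run_expectation_add[symmetric] by (simp add: phase_start_def)
  also have "\<dots> \<le> run_expectation W (phase_start W q) (\<lambda>a. ?bad q a + ?err) run_init"
    using init by (intro run_expectation_mono[OF n, where Q = "prog_bounded W"] step prog_bounded_step)
  also have "\<dots> = run_expectation W (phase_start W q) (?bad q) run_init + ?err"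
    by (rule run_expectation_add_const[OF n])
  also have "\<dots> \<le> (\<Sum>r<q. card (subgroup W (sub_key W r))) / real (nT W) ^ 2 + ?err"
    using Suc by (intro add_right_mono) simp
  also have "\<dots> = (\<Sum>r<Suc q. card (subgroup W (sub_key W r))) / real (nT W) ^ 2"
    by (simp add: add_divide_distrib)
  finally show ?case .
qed

lemma sum_card_subgroup_le: "(\<Sum>r<q. card (subgroup W (sub_key W r))) \<le> nT W"
proof -
  have inj: "r = r'" if "sub_key W r = sub_key W r'" for r r'
    using that unfolding sub_key_def by (metis div_mult_mod_eq prod.inject)
  have "(\<Sum>r<q. card (subgroup W (sub_key W r))) = card (\<Union>r<q. subgroup W (sub_key W r))"
    using inj by (intro card_UN_disjoint[symmetric]) (auto simp: subgroup_def)
  also have "\<dots> \<le> card {..<nT W}" by (intro card_mono) (auto simp: subgroup_def)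
  finally show ?thesis by simp
qed

text \<open>The subgroups are disjoint, so the errors sum to at most \<open>n / n ^ 2\<close>. If no
  phase failed, only read-only transactions are left, and \<open>tau_max W\<close> more steps
  suffice.\<close>

lemma prob_all_committed_ge:
  assumes W: "valid_workload W" "nT W \<ge> 2"
    and t: "t \<ge> phase_start W (ell W * nR W) + tau_max W"
  shows "measure_pmf.prob (nc_dist W t) {\<sigma>. all_committed W \<sigma>} \<ge> 1 - 1 / real (nT W)"
proof -
  let ?q = "ell W * nR W"
  let ?bad = "\<lambda>a. of_bool (\<not> lower_done W (sub_key W ?q) a) :: real"
  let ?live = "\<lambda>a. of_bool (\<exists>v. live W a v) :: real"
  define r where "r = t - phase_start W ?q"
  have r: "t = phase_start W ?q + r" "r \<ge> tau_max W" using t by (auto simp: r_def)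
  have n: "nT W > 0" using W by simp
  have step: "run_expectation W r ?live a \<le> ?bad a" if a: "prog_bounded W a" for a
  proof (cases "lower_done W (sub_key W ?q) a")
    case True
    have wr: "\<not> writing W u" if "live W a u" for u
    proof
      assume u: "writing W u"
      have "grp_idx W u < ell W" using grp_idx_less_ell[OF W(1)] that by (simp add: live_def)
      then have "key_lt (key W u) (sub_key W ?q)"
        using u nR_pos[OF W(1)] by (simp add: key_def sub_key_def key_lt_def)
      then show False using True u that by (auto simp: lower_done_def)
    qed
    have "settled W a v" for v
      using wr unfolding settled_def conflict_def writing_def by blast
    then have 0: "live_prob W r v a = 0" for v
      using a r tau_max_ge[of v W]
      by (intro live_prob_settled) (auto simp: live_def)
    have "run_expectation W r ?live a \<le> run_expectation W r (\<lambda>a. \<Sum>v<nT W. of_bool (live W a v)) a"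
    proof (rule run_expectation_mono[OF n, where Q = "\<lambda>_. True"])
      fix a
      show "?live a \<le> (\<Sum>v<nT W. of_bool (live W a v))"
      proof (cases "\<exists>v. live W a v")
        case True
        then obtain v where v: "live W a v" by blast
        then have "of_bool (live W a v) \<le> (\<Sum>v<nT W. of_bool (live W a v) :: real)"
          by (intro member_le_sum) (auto simp: live_def)
        then show ?thesis using v by auto
      qed (auto intro: sum_nonneg)
    qed auto
    also have "\<dots> = (\<Sum>v<nT W. live_prob W r v a)"
      unfolding live_prob_def by (rule run_expectation_sum[OF n])
    finally show ?thesis by (simp add: 0)
  next
    case False
    have "run_expectation W r ?live a \<le> run_expectation W r (\<lambda>_. 1) a"
      by (rule run_expectation_mono[OF n, where Q = "\<lambda>_. True"]) auto
    then show ?thesis using False by simp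
  qed
  have init: "prog_bounded W run_init"
    using W by (force simp: prog_bounded_def run_init_def valid_workload_def live_def)
  have "run_expectation W t ?live run_init =
        run_expectation W (phase_start W ?q) (run_expectation W r ?live) run_init"
    unfolding r(1) by (rule run_expectation_add)
  also have "\<dots> \<le> run_expectation W (phase_start W ?q) ?bad run_init"
    by (rule run_expectation_mono[OF n, where Q = "prog_bounded W"])
       (use init step in \<open>auto intro: prog_bounded_step\<close>)
  also have "\<dots> \<le> (\<Sum>r<?q. card (subgroup W (sub_key W r))) / real (nT W) ^ 2"
    by (rule prob_not_lower_done[OF W]) simp
  also have "\<dots> \<le> real (nT W) / real (nT W) ^ 2"
    using of_nat_mono[OF sum_card_subgroup_le[where q = ?q and W = W], where 'a = real]
    unfolding of_nat_sum by (intro divide_right_mono) auto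
  also have "\<dots> = 1 / real (nT W)" using n by (simp add: power2_eq_square)
  finally have fail: "run_expectation W t ?live run_init \<le> 1 / real (nT W)" .
  let ?C = "{a. \<forall>i<nT W. fst a i} :: run_state set"
  have "measure_pmf.prob (nc_dist W t) {\<sigma>. all_committed W \<sigma>} = measure_pmf.prob (run_dist W t) ?C"
    by (simp add: proj_nc_dist[symmetric] vimage_def proj_def all_committed_def)
  also have "\<dots> = 1 - measure_pmf.prob (run_dist W t) (- ?C)"
    using measure_pmf.prob_compl[of ?C "run_dist W t"] by (simp add: Compl_eq_Diff_UNIV)
  also have "measure_pmf.prob (run_dist W t) (- ?C) = measure_pmf.expectation (run_dist W t) (indicator (- ?C))"
    by simp
  also have "indicator (- ?C) = ?live" by (auto simp: fun_eq_iff live_def indicator_def)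
  also have "measure_pmf.expectation (run_dist W t) ?live = run_expectation W t ?live run_init"
    by (rule expectation_run_dist[OF n])
  finally show ?thesis using fail by simp
qed

section \<open>Lower bounds on the optimal makespan\<close>

text \<open>Running the transactions one after another is feasible, so the \<open>LEAST\<close> is
  attained.\<close>

lemma makespan_opt_schedule:
  obtains a where "feasible_offline W a" "\<And>i. i < nT W \<Longrightarrow> a i + tau W i \<le> makespan_opt W"
proof -
  let ?a = "\<lambda>i. \<Sum>j<i. tau W j"
  have le: "?a i + tau W i \<le> ?a j" if "i < j" for i j
  proof -
    have "(\<Sum>k<Suc i. tau W k) \<le> ?a j" using that by (intro sum_mono2) auto
    then show ?thesis by simp
  qed
  have "feasible_offline W ?a"
    unfolding feasible_offline_def by (metis le linorder_neqE_nat)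
  moreover have "\<forall>i<nT W. ?a i + tau W i \<le> ?a (nT W)" using le by blast
  ultimately have "\<exists>m a. feasible_offline W a \<and> (\<forall>i<nT W. a i + tau W i \<le> m)" by blast
  from LeastI_ex[OF this] show ?thesis using that unfolding makespan_opt_def by blast
qed

lemma tau_max_le_makespan_opt:
  assumes "nT W \<ge> 1" shows "tau_max W \<le> makespan_opt W"
proof -
  obtain a where "\<And>i. i < nT W \<Longrightarrow> a i + tau W i \<le> makespan_opt W"
    using makespan_opt_schedule by blast
  then have "tau W i \<le> makespan_opt W" if "i < nT W" for i
    using that by (meson add_leD2)
  then show ?thesis unfolding tau_max_def using assms by (subst Max_le_iff) auto
qed

text \<open>The execution intervals of a clique are disjoint subsets of
  \<open>{..<makespan_opt W}\<close>.\<close>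

lemma clique_le_makespan_opt:
  assumes C: "C \<subseteq> {..<nT W}" and tau: "\<And>v. v \<in> C \<Longrightarrow> c \<le> tau W v"
    and conf: "\<And>u v. u \<in> C \<Longrightarrow> v \<in> C \<Longrightarrow> u \<noteq> v \<Longrightarrow> conflict W u v"
  shows "card C * c \<le> makespan_opt W"
proof -
  obtain a where f: "feasible_offline W a" and a: "\<And>i. i < nT W \<Longrightarrow> a i + tau W i \<le> makespan_opt W"
    using makespan_opt_schedule by blast
  have fC: "finite C" using C finite_subset by blast
  have "card C * c \<le> (\<Sum>v\<in>C. tau W v)"
    using sum_bounded_below[of C c "tau W"] tau by simp
  also have "\<dots> = (\<Sum>v\<in>C. card {a v..<a v + tau W v})" by simp
  also have "\<dots> = card (\<Union>v\<in>C. {a v..<a v + tau W v})"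
  proof (rule card_UN_disjoint[symmetric])
    show "\<forall>i\<in>C. \<forall>j\<in>C. i \<noteq> j \<longrightarrow> {a i..<a i + tau W i} \<inter> {a j..<a j + tau W j} = {}"
    proof (intro ballI impI)
      fix i j assume ij: "i \<in> C" "j \<in> C" "i \<noteq> j"
      then have "i < nT W" "j < nT W" using C by auto
      then have "a i + tau W i \<le> a j \<or> a j + tau W j \<le> a i"
        using f conf ij unfolding feasible_offline_def by blast
      then show "{a i..<a i + tau W i} \<inter> {a j..<a j + tau W j} = {}" by auto
    qed
  qed (use fC in auto)
  also have "\<dots> \<le> card {..<makespan_opt W}"
    using C a by (intro card_mono) (force simp: subset_iff)+
  finally show ?thesis by simp
qed

text \<open>The clique bound for the writers of a busiest resource; \<open>time_cap W p\<close> is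
  twice the lower bound on their execution times.\<close>

lemma write_load_le_makespan_opt:
  assumes "valid_workload W"
  shows "write_load W p * time_cap W p \<le> 2 * makespan_opt W"
proof -
  have "write_load W p \<in> (\<lambda>r. card {v \<in> subgroup W p. r \<in> wr W v}) ` {..<nR W}"
    unfolding write_load_def using nR_pos[OF assms] by (intro Max_in) auto
  then obtain r where r: "write_load W p = card {v \<in> subgroup W p. r \<in> wr W v}" by blast
  have "write_load W p * (2 ^ fst p * tau_min W) \<le> makespan_opt W"
    unfolding r
  proof (rule clique_le_makespan_opt)
    show "2 ^ fst p * tau_min W \<le> tau W v" if "v \<in> {v \<in> subgroup W p. r \<in> wr W v}" for v
    proof -
      have v: "v \<in> subgroup W p" "v < nT W" using that by (auto simp: subgroup_def)
      show ?thesis using grp_idx_bounds(1)[OF assms v(2)] subgroup_key[OF v(1)] by simp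
    qed
  qed (auto simp: subgroup_def conflict_def res_def)
  then show ?thesis by (simp add: time_cap_def algebra_simps)
qed

section \<open>Subgroup sizes and the balancing ratio\<close>

lemma lam_w_le_lam: "valid_workload W \<Longrightarrow> v < nT W \<Longrightarrow> lam_w W v \<le> lam W v"
  unfolding lam_w_def lam_def using lam_bounds(3) by (intro card_mono) (auto simp: res_def)

lemma lam_w_pos:
  assumes "valid_workload W" "v < nT W" "writing W v"
  shows "lam_w W v > 0"
proof -
  have "finite (wr W v)" using lam_bounds(3)[OF assms(1,2)] by (simp add: res_def)
  then show ?thesis using assms(3) by (simp add: lam_w_def writing_def card_gt_0_iff)
qed

lemma beta_le:
  assumes "v < nT W" "writing W v"
  shows "beta W \<le> real (lam_w W v) / real (lam W v)"
  unfolding beta_def using assms by (intro Min_le) auto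

lemma beta_bounds:
  assumes "valid_workload W"
  shows "0 < beta W" "beta W \<le> 1"
proof -
  obtain v where v: "v < nT W" "writing W v" using assms by (auto simp: valid_workload_def)
  have "beta W \<in> (\<lambda>i. real (lam_w W i) / real (lam W i)) ` {i. i < nT W \<and> writing W i}"
    unfolding beta_def using v by (intro Min_in) auto
  then obtain u where u: "u < nT W" "writing W u" "beta W = real (lam_w W u) / real (lam W u)" by blast
  then show "0 < beta W" using lam_w_pos[OF assms u(1,2)] lam_bounds(1)[OF assms u(1)] by simp
  show "beta W \<le> 1"
    unfolding u(3) using lam_w_le_lam[OF assms u(1)] lam_bounds(1)[OF assms u(1)] by simp
qed

text \<open>Double counting of pairs of a transaction and a resource it writes: each transaction
  lies in at least \<open>beta W * 2 ^ snd p\<close> pairs, each resource in at most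
  \<open>write_load W p\<close>.\<close>

lemma card_subgroup_le:
  assumes W: "valid_workload W"
  shows "real (card (subgroup W p)) \<le> real (nR W) / beta W / 2 ^ snd p * real (write_load W p)"
proof -
  let ?S = "subgroup W p"
  have "real (card ?S) * (beta W * 2 ^ snd p) = (\<Sum>v\<in>?S. beta W * 2 ^ snd p)" by simp
  also have "\<dots> \<le> (\<Sum>v\<in>?S. real (lam_w W v))"
  proof (intro sum_mono)
    fix v assume v: "v \<in> ?S"
    then have v': "v < nT W" "writing W v" by (auto simp: subgroup_def)
    have l: "real (lam W v) > 0" using lam_bounds(1)[OF W v'(1)] by simp
    have "real (2 ^ snd p) \<le> real (lam W v)"
      using sub_idx_bounds(1)[OF W v'(1)] subgroup_key[OF v] by (simp only: of_nat_le_iff)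
    then have "beta W * 2 ^ snd p \<le> beta W * real (lam W v)"
      using beta_bounds[OF W] by (intro mult_left_mono) auto
    also have "\<dots> \<le> real (lam_w W v)"
      using beta_le[OF v'] l by (simp add: pos_le_divide_eq)
    finally show "beta W * 2 ^ snd p \<le> real (lam_w W v)" .
  qed
  also have "(\<Sum>v\<in>?S. real (lam_w W v)) = real (\<Sum>v\<in>?S. card {r \<in> {..<nR W}. r \<in> wr W v})"
  proof -
    have "{r \<in> {..<nR W}. r \<in> wr W v} = wr W v" if "v \<in> ?S" for v
      using that lam_bounds(4)[OF W, of v] by (auto simp: subgroup_def res_def)
    then show ?thesis by (simp add: lam_w_def)
  qed
  also have "(\<Sum>v\<in>?S. card {r \<in> {..<nR W}. r \<in> wr W v}) = (\<Sum>r<nR W. card {v \<in> ?S. r \<in> wr W v})"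
    by (rule sum_multicount_gen) auto
  also have "\<dots> \<le> (\<Sum>r<nR W. write_load W p)"
    by (intro sum_mono card_writers_le_load) auto
  finally have "real (card ?S) * (beta W * 2 ^ snd p) \<le> real (nR W * write_load W p)" by simp
  then have "real (card ?S) \<le> real (nR W * write_load W p) / (beta W * 2 ^ snd p)"
    using beta_bounds[OF W] by (subst pos_le_divide_eq) auto
  then show ?thesis by (simp add: field_simps)
qed

lemma width_time_cap_le:
  assumes W: "valid_workload W"
  shows "real (width W p * time_cap W p) \<le>
           2 * real (makespan_opt W) * min (8 * 2 ^ snd p) (real (nR W) / beta W / 2 ^ snd p)"
proof -
  let ?h = "min (8 * 2 ^ snd p) (real (nR W) / beta W / 2 ^ snd p)"
  have "real (width W p) = min (8 * 2 ^ snd p * real (write_load W p)) (real (card (subgroup W p)))"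
    by (simp add: width_def of_nat_min)
  also have "\<dots> \<le> min (8 * 2 ^ snd p * real (write_load W p))
                     (real (nR W) / beta W / 2 ^ snd p * real (write_load W p))"
    using card_subgroup_le[OF W, of p] by (intro min.mono) auto
  also have "\<dots> = ?h * real (write_load W p)"
    by (simp add: min_mult_distrib_right)
  finally have "real (width W p) * real (time_cap W p) \<le>
      ?h * real (write_load W p) * real (time_cap W p)" by (intro mult_right_mono) auto
  also have "\<dots> = ?h * real (write_load W p * time_cap W p)" by simp
  also have "\<dots> \<le> ?h * real (2 * makespan_opt W)"
    using write_load_le_makespan_opt[OF W, of p] beta_bounds[OF W]
    by (intro mult_left_mono) (simp_all only: of_nat_le_iff, auto)
  finally show ?thesis by (simp add: mult_ac)
qed

section \<open>Summation over all subgroups\<close>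

lemma sum_lessThan_add:
  fixes f :: "nat \<Rightarrow> 'a::comm_monoid_add"
  shows "sum f {..<m + k} = sum f {..<m} + (\<Sum>i<k. f (m + i))"
  by (induction k) (auto simp: add_ac)

text \<open>The sum is cut where \<open>2 ^ j\<close> passes \<open>sqrt X\<close>: the first terms
  of the minimum give at most \<open>16 * sqrt X\<close> below the cut, the second ones at most
  \<open>2 * sqrt X\<close> above it.\<close>

lemma sum_min_geometric_le:
  fixes X :: real
  assumes X: "X \<ge> 1"
  shows "(\<Sum>j<K. min (8 * 2 ^ j) (X / 2 ^ j)) \<le> 18 * sqrt X"
proof -
  define k where "k = nat \<lfloor>log 2 (sqrt X)\<rfloor>"
  have k: "2 ^ k \<le> sqrt X" "sqrt X \<le> 2 ^ (k + 1)"
    using floor_log2_bounds[of "sqrt X"] X by (auto simp: k_def)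
  have X2: "X = sqrt X * sqrt X" using X by simp
  \<comment> \<open>Adding nonnegative terms makes the cut fit for every \<open>K\<close>.\<close>
  have "(\<Sum>j<K. min (8 * 2 ^ j) (X / 2 ^ j)) \<le> (\<Sum>j<Suc k + K. min (8 * 2 ^ j) (X / 2 ^ j))"
    using X by (intro sum_mono2) auto
  also have "\<dots> = (\<Sum>j<Suc k. min (8 * 2 ^ j) (X / 2 ^ j)) +
                 (\<Sum>i<K. min (8 * 2 ^ (Suc k + i)) (X / 2 ^ (Suc k + i)))"
    by (rule sum_lessThan_add)
  also have "\<dots> \<le> (\<Sum>j<Suc k. 8 * 2 ^ j) + (\<Sum>i<K. X / 2 ^ (Suc k + i))"
    by (intro add_mono sum_mono) auto
  also have "(\<Sum>j<Suc k. 8 * 2 ^ j) = 8 * (2 ^ Suc k - 1 :: real)"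
    by (simp only: sum_distrib_left[symmetric] mask_eq_sum_exp) (simp add: geometric_sum)
  also have "(\<Sum>i<K. X / 2 ^ (Suc k + i)) = X / 2 ^ Suc k * (\<Sum>i<K. (1 / 2) ^ i)"
    by (simp add: sum_distrib_left power_add power_one_over field_simps)
  also have "\<dots> \<le> X / 2 ^ Suc k * 2"
    using X by (intro mult_left_mono) (simp_all add: geometric_sum)
  also have "X / 2 ^ Suc k \<le> sqrt X"
  proof -
    have "X \<le> sqrt X * 2 ^ Suc k"
      by (subst X2, rule mult_left_mono) (use k X in auto)
    then show ?thesis by (simp add: pos_divide_le_eq del: power_Suc)
  qed
  finally show ?thesis using k(1) by simp
qed

lemma sum_mod_periodic:
  "(\<Sum>q<l * K. f (q mod K)) = real l * (\<Sum>j<K. f j)"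
proof (induction l)
  case (Suc l)
  have "(\<Sum>q<l * K + K. f (q mod K)) = (\<Sum>q<l * K. f (q mod K)) + (\<Sum>j<K. f j)"
    unfolding sum_lessThan_add by simp
  then show ?case using Suc by (simp add: algebra_simps)
qed simp

lemma phase_start_le:
  assumes W: "valid_workload W" "nT W \<ge> 2"
  shows "real (phase_start W (ell W * nR W)) \<le>
           512 * exp 1 * real (ell W) * sqrt (real (nR W) / beta W) * ln (real (nT W)) * real (makespan_opt W)"
proof -
  define X where "X = real (nR W) / beta W"
  define h where "h j = min (8 * 2 ^ j) (X / 2 ^ j)" for j :: nat
  let ?n = "real (nT W)" and ?O = "real (makespan_opt W)" and ?k = "real (window_count W)"
  have "beta W * 1 \<le> 1 * real (nR W)"
    using beta_bounds[OF W(1)] nR_pos[OF W(1)] by (intro mult_mono) auto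
  then have X: "X \<ge> 1" using beta_bounds[OF W(1)] by (simp add: X_def pos_le_divide_eq)
  have "ln 2 \<le> ln ?n" using W(2) by (subst ln_le_cancel_iff) auto
  then have ln: "ln ?n \<ge> 2 / 3" using ln2_ge_two_thirds by linarith
  \<comment> \<open>Rounding up costs at most 1, which is at most \<open>3 / 2 * ln n\<close>; hence
    7 + 3/2 = 17/2.\<close>
  then have k: "?k \<le> 17 / 2 * ln ?n" unfolding window_count_def by linarith
  have "real (phase_start W (ell W * nR W)) =
    (\<Sum>q<ell W * nR W. 3 * ?k * real (width W (sub_key W q) * time_cap W (sub_key W q)))"
    by (simp add: phase_start_def mult_ac)
  also have "\<dots> \<le> (\<Sum>q<ell W * nR W. 3 * ?k * (2 * ?O * h (q mod nR W)))"
    using width_time_cap_le[OF W(1)]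
    by (intro sum_mono mult_left_mono) (auto simp: sub_key_def h_def X_def)
  also have "\<dots> = 6 * ?k * ?O * (\<Sum>q<ell W * nR W. h (q mod nR W))"
    by (simp add: sum_distrib_left mult_ac)
  also have "\<dots> = 6 * ?k * ?O * (real (ell W) * (\<Sum>j<nR W. h j))"
    by (simp only: sum_mod_periodic)
  also have "\<dots> \<le> 6 * (17 / 2 * ln ?n) * ?O * (real (ell W) * (18 * sqrt X))"
    unfolding h_def using sum_min_geometric_le[OF X] k X ln
    by (intro mult_mono) (auto intro!: sum_nonneg mult_nonneg_nonneg)
  also have "\<dots> = 918 * (real (ell W) * sqrt X * ln ?n * ?O)" by simp
  \<comment> \<open>The constant is 6 * 17/2 * 18 = 918, below 1024, and \<open>exp 1\<close> is at
    least 2.\<close>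
  also have "\<dots> \<le> (512 * exp 1) * (real (ell W) * sqrt X * ln ?n * ?O)"
    using exp_ge_add_one_self[of 1] X ln by (intro mult_right_mono) auto
  finally show ?thesis by (simp add: X_def mult_ac)
qed

theorem mainTheorem11:
  fixes W :: workload
  assumes "valid_workload W" and "nT W \<ge> 2"
  shows "prob_makespan_NC_le W
           ((512 * exp 1 * real (ell W) * sqrt (real (nR W) / beta W) * ln (real (nT W)) + 1)
              * real (makespan_opt W))
         \<ge> 1 - 1 / real (nT W)"
  unfolding prob_makespan_NC_le_def
proof (rule prob_all_committed_ge[OF assms])
  \<comment> \<open>The summand 1 in the ratio pays for the final \<open>tau_max W\<close>
    steps.\<close>
  have "real (phase_start W (ell W * nR W) + tau_max W) \<le>
    (512 * exp 1 * real (ell W) * sqrt (real (nR W) / beta W) * ln (real (nT W)) + 1)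
      * real (makespan_opt W)"
    using phase_start_le[OF assms] tau_max_le_makespan_opt[of W] assms(2)
    by (simp add: distrib_right)
  then show "phase_start W (ell W * nR W) + tau_max W \<le>
    nat \<lfloor>(512 * exp 1 * real (ell W) * sqrt (real (nR W) / beta W) * ln (real (nT W)) + 1)
      * real (makespan_opt W)\<rfloor>"
    by (rule le_nat_floor)
qed

end
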